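(* Let $t\ge2$, $n\ge1$, $\omega$ a primitive $t$-th root of unity, $X=(x_1,\dots,x_n)$, $X^t=(x_1^t,\dots,x_n^t)$, $\overline{X}^t=(x_1^{-t},\dots,x_n^{-t})$, $-X^t=(-x_1^t,\dots,-x_n^t)$. Let $\lambda$ be a partition with $\ell(\lambda)\le tn$, with $n_i=n_i(\lambda,tn)$ and $t$-quotient $(\lambda^{(0)},\dots,\lambda^{(t-1)})$ computed with $m=tn$. Consider the even orthogonal character $\mathrm{o}^{\mathrm{even}}_\lambda$ in the $tn$ variables $(X,\omega X,\dots,\omega^{t-1}X)$. (1) If the $t$-core of $\lambda$ is not an orthogonal $t$-core, then $\mathrm{o}^{\mathrm{even}}_\lambda(X,\omega X,\dots,\omega^{t-1}X)=0$. (2) If the $t$-core of $\lambda$ is an orthogonal $t$-core of rank $r$, then \[ \mathrm{o}^{\mathrm{even}}_\lambda(X,\omega X,\dots,\omega^{t-1}X)=(-1)^{\epsilon}\operatorname{sgn}(\sigma_\lambda)\,\mathrm{o}^{\mathrm{even}}_{\lambda^{(0)}}(X^t)\prod_{i=1}^{\lfloor (t-1)/2\rfloor} s_{\mu^{(2)}_i}(X^t,\overline{X}^t)\times\begin{cases}(-1)^{\sum_{j=1}^n\lambda^{(t/2)}_j}\,\mathrm{so}_{\lambda^{(t/2)}}(-X^t)& t\text{ even},\\ 1 & t\text{ odd},\end{cases} \] where $\epsilon=-\sum_{i=\lfloor (t+2)/2\rfloor}^{t-1}\binom{n_i}{2}+\begin{cases}\frac{n(n+t-1)}2+nr & t\text{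 even},\\ \frac{(t-1)n}{2}& t\text{ odd},\end{cases}$ and, for $1\le i\le\lfloor(t-1)/2\rfloor$, $\mu^{(2)}_i$ is the sequence of length $2n$ whose $j$-th entry is $\lambda^{(t-i)}_1+\lambda^{(i)}_j$ for $1\le j\le n_i$ and $\lambda^{(t-i)}_1-\lambda^{(t-i)}_{2n+1-j}$ for $n_i<j\le 2n$ (i.e. $\lambda^{(t-i)}_1+(\lambda^{(i)},-\mathrm{rev}(\lambda^{(t-i)}))$).
   Context: Beta sets and $t$-quotients: for $\ell(\lambda)\le m$, $\beta(\lambda,m)=(\lambda_j+m-j)_{j=1}^m$; $n_i(\lambda,m)$ is the number of entries congruent to $i$ mod $t$; writing those entries in decreasing order as $t\tilde\beta^{(i)}_j+i$ ($1\le j\le n_i$), $\lambda^{(i)}$ is the partition with $n_i$ parts (possibly zero) $\lambda^{(i)}_j=\tilde\beta^{(i)}_j-n_i+j$. The $t$-core is obtained by successively removing border strips of size $t$. Frobenius coordinates: if $\rho$ has rank $k$ (largest $k$ with $\rho_k\ge k$), $\rho=(\alpha|\beta)$ with $\alpha_i=\rho_i-i$, $\beta_i=\rho'_i-i$. A partition is orthogonal if it has the form $(\alpha|\alpha-1)$, i.e. $\beta_i=\alpha_i-1$ for all $i$ (empty partition included); an orthogonal $t$-core is an orthogonal partition that is a $t$-core. $\sigma_\lambda\in S_{tn}$ is the permutation such that $(\beta_{\sigma_\lambda(1)},\dots,\beta_{\sigma_\lambda(tn)})$ (with $\beta=\beta(\lambda,tn)$) lists the entries congruent to $0$ mod $t$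 in decreasing order, then those congruent to $1$, ..., then those congruent to $t-1$. Characters in $N$ variables $y$, for a weakly decreasing integer sequence $\mu$ of length $N$: $s_\mu(y)=\det(y_i^{\mu_j+N-j})/\det(y_i^{N-j})$; $\mathrm{so}_\mu(y)=\det(y_i^{\mu_j+N-j+1}-y_i^{-(\mu_j+N-j)})/\det(y_i^{N-j+1}-y_i^{-(N-j)})$; $\mathrm{o}^{\mathrm{even}}_\mu(y)=\det(y_i^{\mu_j+N-j}+y_i^{-(\mu_j+N-j)})/\big((1+\delta_{\mu_N,0})\det(y_i^{N-j}+y_i^{-(N-j)})\big)$, $\delta$ the Kronecker delta. Here $\mathrm{o}^{\mathrm{even}}_{\lambda^{(0)}}$ and $\mathrm{so}_{\lambda^{(t/2)}}$ are in $n$ variables and $s_{\mu^{(2)}_i}$ in $2n$ variables. *)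

theory Defs
  imports "Jordan_Normal_Form.Determinant" "HOL-Combinatorics.Permutations"
begin

text \<open>
  All sequences are indexed from 0, so \<open>\<lambda> j\<close> is the part written \<open>\<lambda>\<^sub>j\<^sub>+\<^sub>1\<close> in the usual
  1-based notation. A partition is an infinite sequence, padded with zeros.
\<close>

definition is_partition :: "(nat \<Rightarrow> nat) \<Rightarrow> bool" where
  "is_partition l \<longleftrightarrow> antimono l \<and> finite {j. l j \<noteq> 0}"

definition num_parts :: "(nat \<Rightarrow> nat) \<Rightarrow> nat" where
  "num_parts l = card {j. l j \<noteq> 0}"

definition conjugate :: "(nat \<Rightarrow> nat) \<Rightarrow> nat \<Rightarrow> nat" where
  "conjugate l j = card {i. j < l i}"

definition diagram :: "(nat \<Rightarrow> nat) \<Rightarrow> (nat \<times> nat) set" where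
  "diagram l = {(i, j). j < l i}"


section \<open>Border strips and cores\<close>

definition adjacent_cells :: "nat \<times> nat \<Rightarrow> nat \<times> nat \<Rightarrow> bool" where
  "adjacent_cells c d \<longleftrightarrow>
     (fst c = fst d \<and> (snd d = Suc (snd c) \<or> snd c = Suc (snd d))) \<or>
     (snd c = snd d \<and> (fst d = Suc (fst c) \<or> fst c = Suc (fst d)))"

definition connected_cells :: "(nat \<times> nat) set \<Rightarrow> bool" where
  "connected_cells D \<longleftrightarrow>
     (\<forall>c\<in>D. \<forall>d\<in>D. (c, d) \<in> {(a, b). a \<in> D \<and> b \<in> D \<and> adjacent_cells a b}\<^sup>*)"

definition border_strip :: "(nat \<times> nat) set \<Rightarrow> bool" where
  "border_strip D \<longleftrightarrow> D \<noteq> {} \<and> connected_cells D \<and>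
     \<not> (\<exists>i j. {(i, j), (i, Suc j), (Suc i, j), (Suc i, Suc j)} \<subseteq> D)"

definition remove_border_strip :: "nat \<Rightarrow> (nat \<Rightarrow> nat) \<Rightarrow> (nat \<Rightarrow> nat) \<Rightarrow> bool" where
  "remove_border_strip t l m \<longleftrightarrow> is_partition l \<and> is_partition m \<and> diagram m \<subseteq> diagram l \<and>
     border_strip (diagram l - diagram m) \<and> card (diagram l - diagram m) = t"

definition is_t_core :: "nat \<Rightarrow> (nat \<Rightarrow> nat) \<Rightarrow> bool" where
  "is_t_core t l \<longleftrightarrow> is_partition l \<and> \<not> (\<exists>m. remove_border_strip t l m)"

definition t_core :: "nat \<Rightarrow> (nat \<Rightarrow> nat) \<Rightarrow> nat \<Rightarrow> nat" where
  "t_core t l = (THE r. (remove_border_strip t)\<^sup>*\<^sup>* l r \<and> is_t_core t r)"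


section \<open>Frobenius coordinates\<close>

definition partition_rank :: "(nat \<Rightarrow> nat) \<Rightarrow> nat" where
  "partition_rank l = (GREATEST k. k = 0 \<or> k \<le> l (k - 1))"

text \<open>
  For \<open>i < partition_rank l\<close> these are the Frobenius coordinates \<open>\<alpha>\<close> and \<open>\<beta>\<close>. They are
  integers so that \<open>\<alpha> - 1\<close> is not truncated at 0.
\<close>

definition frob_arm :: "(nat \<Rightarrow> nat) \<Rightarrow> nat \<Rightarrow> int" where
  "frob_arm l i = int (l i) - int (Suc i)"

definition frob_leg :: "(nat \<Rightarrow> nat) \<Rightarrow> nat \<Rightarrow> int" where
  "frob_leg l i = int (conjugate l i) - int (Suc i)"

definition orthogonal_partition :: "(nat \<Rightarrow> nat) \<Rightarrow> bool" where
  "orthogonal_partition l \<longleftrightarrow> is_partition l \<and>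
     (\<forall>i < partition_rank l. frob_leg l i = frob_arm l i - 1)"

definition orthogonal_t_core :: "nat \<Rightarrow> (nat \<Rightarrow> nat) \<Rightarrow> bool" where
  "orthogonal_t_core t l \<longleftrightarrow> orthogonal_partition l \<and> is_t_core t l"


section \<open>Beta sets and quotients\<close>

definition beta :: "(nat \<Rightarrow> nat) \<Rightarrow> nat \<Rightarrow> nat \<Rightarrow> nat" where
  "beta l m j = l j + (m - Suc j)"

text \<open>The entries congruent to \<open>i\<close> modulo \<open>t\<close>, in decreasing order.\<close>

definition beta_residue :: "nat \<Rightarrow> (nat \<Rightarrow> nat) \<Rightarrow> nat \<Rightarrow> nat \<Rightarrow> nat list" where
  "beta_residue t l m i = rev (sorted_list_of_set {b \<in> beta l m ` {..<m}. b mod t = i})"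

definition beta_count :: "nat \<Rightarrow> (nat \<Rightarrow> nat) \<Rightarrow> nat \<Rightarrow> nat \<Rightarrow> nat" where
  "beta_count t l m i = card {j. j < m \<and> beta l m j mod t = i}"

text \<open>
  The subtraction is never truncated: the quotients by \<open>t\<close> of the entries in
  \<open>beta_residue t l m i\<close> are strictly decreasing natural numbers.
\<close>

definition t_quotient :: "nat \<Rightarrow> (nat \<Rightarrow> nat) \<Rightarrow> nat \<Rightarrow> nat \<Rightarrow> nat \<Rightarrow> nat" where
  "t_quotient t l m i j =
     (if j < beta_count t l m i
      then beta_residue t l m i ! j div t - (beta_count t l m i - Suc j) else 0)"

definition sorting_perm :: "nat \<Rightarrow> (nat \<Rightarrow> nat) \<Rightarrow> nat \<Rightarrow> nat \<Rightarrow> nat" where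
  "sorting_perm t l m = (THE p. p permutes {..<m} \<and>
     map (\<lambda>k. beta l m (p k)) [0..<m] = concat (map (beta_residue t l m) [0..<t]))"


section \<open>Characters\<close>

text \<open>
  In each case \<open>N\<close> is the number of variables \<open>y 0, \<dots>, y (N - 1)\<close>, and only
  \<open>\<mu> 0, \<dots>, \<mu> (N - 1)\<close> are used.
\<close>

definition schur_char :: "nat \<Rightarrow> (nat \<Rightarrow> int) \<Rightarrow> (nat \<Rightarrow> 'a::field) \<Rightarrow> 'a" where
  "schur_char N \<mu> y =
     det (mat N N (\<lambda>(i, j). y i powi (\<mu> j + int N - int (Suc j)))) /
     det (mat N N (\<lambda>(i, j). y i powi (int N - int (Suc j))))"

definition so_char :: "nat \<Rightarrow> (nat \<Rightarrow> int) \<Rightarrow> (nat \<Rightarrow> 'a::field) \<Rightarrow> 'a" where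
  "so_char N \<mu> y =
     det (mat N N (\<lambda>(i, j). y i powi (\<mu> j + int N - int (Suc j) + 1)
                           - y i powi (- (\<mu> j + int N - int (Suc j))))) /
     det (mat N N (\<lambda>(i, j). y i powi (int N - int (Suc j) + 1)
                           - y i powi (- (int N - int (Suc j)))))"

definition oeven_denom :: "nat \<Rightarrow> (nat \<Rightarrow> 'a::field) \<Rightarrow> 'a" where
  "oeven_denom N y =
     det (mat N N (\<lambda>(i, j). y i powi (int N - int (Suc j))
                           + y i powi (- (int N - int (Suc j)))))"

definition oeven_char :: "nat \<Rightarrow> (nat \<Rightarrow> int) \<Rightarrow> (nat \<Rightarrow> 'a::field) \<Rightarrow> 'a" where
  "oeven_char N \<mu> y =
     det (mat N N (\<lambda>(i, j). y i powi (\<mu> j + int N - int (Suc j))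
                           + y i powi (- (\<mu> j + int N - int (Suc j))))) /
     ((if \<mu> (N - 1) = 0 then 2 else 1) * oeven_denom N y)"


section \<open>Data of the factorization\<close>

definition primitive_root_of_unity :: "nat \<Rightarrow> 'a::field \<Rightarrow> bool" where
  "primitive_root_of_unity t w \<longleftrightarrow> w ^ t = 1 \<and> (\<forall>k. 0 < k \<and> k < t \<longrightarrow> w ^ k \<noteq> 1)"

text \<open>The variables \<open>(X, \<omega> X, \<omega>\<^sup>2 X, \<dots>)\<close>, listed in blocks of length \<open>n\<close>.\<close>

definition twisted_vars :: "nat \<Rightarrow> 'a::field \<Rightarrow> (nat \<Rightarrow> 'a) \<Rightarrow> nat \<Rightarrow> 'a" where
  "twisted_vars n w x k = w ^ (k div n) * x (k mod n)"

text \<open>The \<open>2n\<close> variables consisting of the \<open>t\<close>-th powers, then their inverses.\<close>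

definition power_inverse_vars :: "nat \<Rightarrow> nat \<Rightarrow> (nat \<Rightarrow> 'a::field) \<Rightarrow> nat \<Rightarrow> 'a" where
  "power_inverse_vars t n x k =
     (if k < n then x k powi int t else x (k - n) powi (- int t))"

definition mu2 :: "nat \<Rightarrow> nat \<Rightarrow> (nat \<Rightarrow> nat) \<Rightarrow> nat \<Rightarrow> nat \<Rightarrow> int" where
  "mu2 t n l i j =
     (if j < beta_count t l (t * n) i
      then int (t_quotient t l (t * n) (t - i) 0) + int (t_quotient t l (t * n) i j)
      else int (t_quotient t l (t * n) (t - i) 0)
           - int (t_quotient t l (t * n) (t - i) (2 * n - Suc j)))"

text \<open>Both divisions by 2 are exact.\<close>

definition sign_exponent :: "nat \<Rightarrow> nat \<Rightarrow> (nat \<Rightarrow> nat) \<Rightarrow> nat \<Rightarrow> int" where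
  "sign_exponent t n l r =
     - (\<Sum>i = (t + 2) div 2..t - 1. int (beta_count t l (t * n) i choose 2))
     + (if even t then int (n * (n + t - 1) div 2 + n * r) else int ((t - 1) * n div 2))"

end

theory Submission
  imports Defs
begin

text \<open>
  A discrete Fourier transform over the \<open>t\<close> row blocks \<open>X, \<omega> X, \<dots>\<close> turns the numerator of
  \<open>o\<^sup>e\<^sup>v\<^sup>e\<^sup>n\<close> into a matrix whose \<open>k\<close>-th row block meets only the columns with exponents congruent
  to \<open>\<plusminus> k\<close> modulo \<open>t\<close>. Its determinant vanishes unless \<open>n\<^sub>0 = n\<close> and \<open>n\<^sub>i + n\<^sub>t\<^sub>-\<^sub>i = 2 n\<close>; in that case it
  splits into one block for the residue 0, one block for each pair \<open>{i, t - i}\<close> and, for even \<open>t\<close>,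
  one block for \<open>t / 2\<close>. These are, up to sign, the numerators of the characters on the right-hand
  side, and the denominators come from the same factorization for the empty partition.

  Removing a border strip of size \<open>t\<close> moves one bead down by \<open>t\<close> and so preserves all \<open>n\<^sub>i\<close>, and a
  \<open>t\<close>-core has no room for such a move. Hence the \<open>n\<^sub>i\<close> determine the core. Reading off Frobenius
  coordinates from the beads shows that the core is orthogonal exactly when the above conditions
  on the \<open>n\<^sub>i\<close> hold, and that its rank is \<open>\<Sum>\<^sub>i max 0 (n\<^sub>i - n)\<close>.
\<close>

section \<open>Bead sets and border strips\<close>

text \<open>The signs shape the proof. Determinants carry lists of row and column labels, so every
  block move or reversal is an operation on lists that costs an explicit power of -1, and exponents
  are compared only modulo 2. Numerator and denominator undergo the same Fourier step, so the
  determinant of the Fourier matrix and the powers of \<open>t\<close> cancel and are never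
  evaluated.

  The rank comes from the block moves. For even \<open>t\<close> the pair \<open>{i, t - i}\<close>
  costs \<open>n * (n_(t-i) + n)\<close> modulo 2, and \<open>|n_i - n|\<close>, which has the
  parity of the second factor, is the share of the pair in the rank. For odd \<open>t\<close> the
  blocks pass stretches of even length, which leaves no such term.

  Beads sit on all integers, shifted so that orthogonality becomes a reflection: 0 is vacant, and
  \<open>a > 0\<close> is occupied exactly when \<open>-a\<close> is vacant. Negation sends residue
  \<open>i\<close> to \<open>t - i\<close>, the same pairing that \<open>y^c + y^(-c)\<close>
  produces in the characters; hence the same conditions on the \<open>n_i\<close> appear on both
  sides.\<close>

text \<open>
  For \<open>i < N\<close> this is \<open>beta l N i - N\<close>, so the set of beads no longer depends on \<open>N\<close>. For a
  partition the range contains all sufficiently small integers.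
\<close>

definition maya :: "(nat \<Rightarrow> nat) \<Rightarrow> nat \<Rightarrow> int" where
  "maya l i = int (l i) - int i - 1"

lemma maya_strict_decreasing:
  assumes "antimono l" "i < j"
  shows "maya l j < maya l i"
  using antimonoD[OF assms(1), of i j] assms(2) by (simp add: maya_def)

lemma maya_less_iff:
  assumes "antimono l"
  shows "maya l j < maya l i \<longleftrightarrow> i < j"
  using maya_strict_decreasing[OF assms, of i j] maya_strict_decreasing[OF assms, of j i]
  by (cases i j rule: linorder_cases) auto

lemma maya_eq_iff:
  assumes "antimono l"
  shows "maya l i = maya l j \<longleftrightarrow> i = j"
  using maya_less_iff[OF assms, of i j] maya_less_iff[OF assms, of j i]
  by (cases i j rule: linorder_cases) auto

text \<open>At the least index of disagreement the larger of the two values would have to occur in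
  the other sequence at an earlier index, where both agree, against strict decrease.
  \<open>A\<close> is an initial segment because the fact is applied both to all of
  \<open>nat\<close> and to \<open>{..<r}\<close>.\<close>

lemma decreasing_enumeration_unique:
  fixes f g :: "nat \<Rightarrow> int"
  assumes f: "\<And>i j. i < j \<Longrightarrow> j \<in> A \<Longrightarrow> f j < f i"
    and g: "\<And>i j. i < j \<Longrightarrow> j \<in> A \<Longrightarrow> g j < g i"
    and A: "\<And>i j. i < j \<Longrightarrow> j \<in> A \<Longrightarrow> i \<in> A"
    and eq: "f ` A = g ` A"
  shows "i \<in> A \<Longrightarrow> f i = g i"
proof (induction i rule: less_induct)
  case (less i)
  have IH: "f j = g j" if "j < i" for j using less that A by blast
  obtain k where k: "k \<in> A" "f i = g k" using eq less.prems by blast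
  have "\<not> k < i" using k IH[of k] f[of k i] less.prems by auto
  then have "f i \<le> g i" using k g[of i k] by (cases "k = i") auto
  obtain k where k: "k \<in> A" "g i = f k" using eq less.prems by blast
  have "\<not> k < i" using k IH[of k] g[of k i] less.prems by auto
  then have "g i \<le> f i" using k f[of i k] by (cases "k = i") auto
  with \<open>f i \<le> g i\<close> show ?case by simp
qed

lemma maya_range_inject:
  assumes "antimono l" "antimono m" "range (maya l) = range (maya m)"
  shows "l = m"
proof
  fix i
  have "maya l i = maya m i"
    by (rule decreasing_enumeration_unique[of UNIV])
      (use assms maya_strict_decreasing in auto)
  then show "l i = m i" by (simp add: maya_def)
qed

lemma partition_bounded:
  assumes "is_partition l"
  obtains M where "\<And>j. M \<le> j \<Longrightarrow> l j = 0"
proof -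
  have "finite {j. l j \<noteq> 0}" using assms by (simp add: is_partition_def)
  then obtain M where "\<forall>j\<in>{j. l j \<noteq> 0}. j < M" using finite_nat_set_iff_bounded by blast
  then show ?thesis using that[of M] by (auto simp: not_less[symmetric])
qed

lemma num_parts_le_iff:
  assumes "is_partition l"
  shows "num_parts l \<le> N \<longleftrightarrow> (\<forall>j\<ge>N. l j = 0)"
proof
  have anti: "antimono l" and fin: "finite {j. l j \<noteq> 0}"
    using assms by (auto simp: is_partition_def)
  assume le: "num_parts l \<le> N"
  show "\<forall>j\<ge>N. l j = 0"
  proof (rule ccontr)
    assume "\<not> (\<forall>j\<ge>N. l j = 0)"
    then obtain j where "j \<ge> N" "l j \<noteq> 0" by blast
    then have "{..j} \<subseteq> {j. l j \<noteq> 0}" using antimonoD[OF anti] by fastforce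
    then have "card {..j} \<le> num_parts l" unfolding num_parts_def by (rule card_mono[OF fin])
    then show False using le \<open>j \<ge> N\<close> by simp
  qed
next
  assume 0: "\<forall>j\<ge>N. l j = 0"
  have "j < N" if "l j \<noteq> 0" for j using that 0 by (cases "j < N") auto
  then have "{j. l j \<noteq> 0} \<subseteq> {..<N}" by auto
  then have "card {j. l j \<noteq> 0} \<le> card {..<N}" by (intro card_mono) auto
  then show "num_parts l \<le> N" by (simp add: num_parts_def)
qed

lemma diagram_subset_iff: "diagram m \<subseteq> diagram l \<longleftrightarrow> (\<forall>i. m i \<le> l i)"
proof
  assume a: "diagram m \<subseteq> diagram l"
  show "\<forall>i. m i \<le> l i"
  proof (rule ccontr)
    assume "\<not> (\<forall>i. m i \<le> l i)"
    then obtain i where "l i < m i" by (auto simp: not_le)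
    then have "(i, l i) \<in> diagram m" by (simp add: diagram_def)
    with a show False by (auto simp: diagram_def)
  qed
qed (auto simp: diagram_def intro: less_le_trans)

lemma finite_diagram:
  assumes "is_partition l"
  shows "finite (diagram l)"
proof -
  obtain M where M: "\<And>j. M \<le> j \<Longrightarrow> l j = 0" using partition_bounded[OF assms] by blast
  have "diagram l = (SIGMA i:{..<M}. {..<l i})"
    using M by (fastforce simp: diagram_def not_le[symmetric])
  then show ?thesis by simp
qed

text \<open>
  The strip meets the rows \<open>p, \<dots>, q\<close>. The equation \<open>l (Suc i) = Suc (m i)\<close> says that consecutive
  rows overlap in exactly one column: at least one by connectedness, at most one because there is
  no square.
\<close>

definition strip_rows :: "(nat \<Rightarrow> nat) \<Rightarrow> (nat \<Rightarrow> nat) \<Rightarrow> nat \<Rightarrow> nat \<Rightarrow> bool" where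
  "strip_rows l m p q \<longleftrightarrow> p \<le> q \<and> (\<forall>i. p \<le> i \<and> i \<le> q \<longrightarrow> m i < l i) \<and>
     (\<forall>i. p \<le> i \<and> i < q \<longrightarrow> l (Suc i) = Suc (m i)) \<and> (\<forall>i. i < p \<or> q < i \<longrightarrow> l i = m i)"

text \<open>Row \<open>i\<close> of the strip has \<open>maya l i - maya m i\<close> cells, and the
  overlap condition reads \<open>maya m i = maya l (Suc i)\<close>, so the row sums
  telescope.\<close>

lemma strip_rows_card:
  assumes "strip_rows l m p q"
  shows "int (card (diagram l - diagram m)) = maya l p - maya m q"
proof -
  have pq: "p \<le> q" and step: "\<And>i. p \<le> i \<Longrightarrow> i < q \<Longrightarrow> l (Suc i) = Suc (m i)"
    and out: "\<And>i. i < p \<or> q < i \<Longrightarrow> l i = m i" and lt: "\<And>i. p \<le> i \<Longrightarrow> i \<le> q \<Longrightarrow> m i < l i"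
    using assms by (auto simp: strip_rows_def)
  have "diagram l - diagram m = (SIGMA i:{p..q}. {m i..<l i})"
    using out by (force simp: diagram_def not_less not_le)
  then have "int (card (diagram l - diagram m)) = (\<Sum>i = p..q. int (l i - m i))"
    by simp
  also have "\<dots> = (\<Sum>i = p..q. maya l i - maya m i)"
    using lt by (intro sum.cong) (auto simp: maya_def of_nat_diff less_imp_le)
  also have "\<dots> = maya l p - maya m q"
    using pq step
  proof (induction q rule: dec_induct)
    case (step q)
    then show ?case by (simp add: maya_def)
  qed simp
  finally show ?thesis .
qed

text \<open>Within the strip the beads of \<open>m\<close> are those of \<open>l\<close> with the
  index shifted by one, so only the first bead of \<open>l\<close> and the last bead of
  \<open>m\<close> stay unmatched. The new bead was vacant in \<open>l\<close>: it lies below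
  \<open>maya l p\<close>, and every other bead of \<open>l\<close> is a bead of \<open>m\<close>
  with an index different from \<open>q\<close>.\<close>

lemma strip_rows_maya:
  assumes s: "strip_rows l m p q" and anti: "antimono l" "antimono m"
  shows "range (maya m) = range (maya l) - {maya l p} \<union> {maya m q}"
    and "maya m q \<notin> range (maya l)"
proof -
  have pq: "p \<le> q" and step: "\<And>i. p \<le> i \<Longrightarrow> i < q \<Longrightarrow> l (Suc i) = Suc (m i)"
    and out: "\<And>i. i < p \<or> q < i \<Longrightarrow> l i = m i" and lt: "\<And>i. p \<le> i \<Longrightarrow> i \<le> q \<Longrightarrow> m i < l i"
    using s by (auto simp: strip_rows_def)
  have st: "maya m i = maya l (Suc i)" if "p \<le> i" "i < q" for i
    using step[OF that] by (simp add: maya_def)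
  have ou: "maya l i = maya m i" if "i < p \<or> q < i" for i
    using out[OF that] by (simp add: maya_def)
  have from_l: "maya l j \<in> maya m ` (- {q})" if "j \<noteq> p" for j
  proof (cases "j < p \<or> q < j")
    case True
    then show ?thesis using ou pq by (intro image_eqI[of _ _ j]) auto
  next
    case False
    with that obtain i where "j = Suc i" "p \<le> i" "i < q" by (cases j) auto
    then show ?thesis using st by (intro image_eqI[of _ _ i]) auto
  qed
  have from_m: "maya m j \<in> maya l ` (- {p})" if "j \<noteq> q" for j
  proof (cases "j < p \<or> q < j")
    case True
    then show ?thesis using ou[OF True] pq by (intro image_eqI[of _ _ j]) auto
  next
    case False
    then have "p \<le> j" "j < q" using that by auto
    then show ?thesis using st by (intro image_eqI[of _ _ "Suc j"]) auto
  qed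
  have "maya m q < maya l p"
    using lt[of p] pq maya_strict_decreasing[OF anti(2), of p q]
    by (cases "p = q") (auto simp: maya_def)
  moreover have "maya m q \<noteq> maya l j" if "j \<noteq> p" for j
    using from_l[OF that] maya_eq_iff[OF anti(2)] by auto
  ultimately show notin: "maya m q \<notin> range (maya l)" by (metis image_iff less_irrefl)
  show "range (maya m) = range (maya l) - {maya l p} \<union> {maya m q}"
  proof (intro equalityI subsetI)
    fix y assume "y \<in> range (maya m)"
    then obtain j where j: "y = maya m j" by blast
    show "y \<in> range (maya l) - {maya l p} \<union> {maya m q}"
      using from_m[of j] j maya_eq_iff[OF anti(1)] by (cases "j = q") auto
  next
    fix y assume "y \<in> range (maya l) - {maya l p} \<union> {maya m q}"
    then show "y \<in> range (maya m)" using from_l by fastforce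
  qed
qed

lemma remove_border_strip_rows:
  assumes "remove_border_strip t l m"
  obtains p q where "strip_rows l m p q"
proof -
  define D where "D = diagram l - diagram m"
  have parts: "is_partition l" "is_partition m" and le: "\<And>i. m i \<le> l i"
    and ne: "D \<noteq> {}" and conn: "connected_cells D"
    and sq: "\<And>i j. \<not> {(i, j), (i, Suc j), (Suc i, j), (Suc i, Suc j)} \<subseteq> D"
    using assms by (auto simp: remove_border_strip_def border_strip_def D_def diagram_subset_iff)
  have anti: "antimono l" "antimono m" using parts by (auto simp: is_partition_def)
  have D: "(i, j) \<in> D \<longleftrightarrow> m i \<le> j \<and> j < l i" for i j
    by (auto simp: D_def diagram_def)
  define I where "I = {i. m i < l i}"
  have "I \<subseteq> {i. l i \<noteq> 0}" by (auto simp: I_def)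
  then have finI: "finite I" using parts finite_subset by (auto simp: is_partition_def)
  have neI: "I \<noteq> {}" using ne D unfolding I_def by (metis (mono_tags, lifting) empty_Collect_eq ex_in_conv le_less_trans surj_pair)
  define p q where "p = Min I" and "q = Max I"
  have pI: "p \<in> I" and qI: "q \<in> I" using finI neI by (auto simp: p_def q_def)
  have pq: "p \<le> q" using finI qI by (auto simp: p_def)
  have step: "l (Suc i) = Suc (m i)" if i: "p \<le> i" "i < q" for i
  proof (rule antisym)
    show "l (Suc i) \<le> Suc (m i)"
    proof (rule ccontr)
      assume "\<not> l (Suc i) \<le> Suc (m i)"
      then have "{(i, m i), (i, Suc (m i)), (Suc i, m i), (Suc i, Suc (m i))} \<subseteq> D"
        using antimonoD[OF anti(1), of i "Suc i"] antimonoD[OF anti(2), of i "Suc i"]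
        by (auto simp: D)
      then show False using sq by blast
    qed
    show "Suc (m i) \<le> l (Suc i)"
    proof (rule ccontr)
      assume a: "\<not> Suc (m i) \<le> l (Suc i)"
      have cells: "(p, m p) \<in> D" "(q, m q) \<in> D" using pI qI by (auto simp: D I_def)
      then have "((p, m p), (q, m q)) \<in> {(a, b). a \<in> D \<and> b \<in> D \<and> adjacent_cells a b}\<^sup>*"
        using conn by (auto simp: connected_cells_def)
      \<comment> \<open>Invariant of the path: crossing from row \<open>i\<close> to row
        \<open>i + 1\<close> needs a column common to both, and the assumption leaves none.\<close>
      then have "fst (q, m q) \<le> i"
      proof (induction rule: rtrancl_induct)
        case base
        then show ?case using i by simp
      next
        case (step y z)
        obtain y1 y2 z1 z2 where yz: "y = (y1, y2)" "z = (z1, z2)" by (cases y, cases z)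
        show ?case
        proof (rule ccontr)
          assume "\<not> fst z \<le> i"
          then have "y1 = i" "z1 = Suc i" "y2 = z2"
            using step yz by (auto simp: adjacent_cells_def)
          then show False using step yz a by (auto simp: D)
        qed
      qed
      then show False using i by simp
    qed
  qed
  have "strip_rows l m p q"
    unfolding strip_rows_def
  proof (intro conjI allI impI)
    fix i assume i: "p \<le> i \<and> i \<le> q"
    show "m i < l i"
    proof (cases "i = q")
      case True
      then show ?thesis using qI by (simp add: I_def)
    next
      case False
      then have "l (Suc i) = Suc (m i)" using step i by auto
      then show ?thesis using antimonoD[OF anti(1), of i "Suc i"] by simp
    qed
  next
    fix i assume "i < p \<or> q < i"
    then have "i \<notin> I" using finI by (auto simp: p_def q_def not_le dest: Min_le Max_ge)
    then show "l i = m i" using le[of i] by (simp add: I_def)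
  qed (use pq step in auto)
  then show ?thesis by (rule that)
qed

lemma remove_border_strip_maya:
  assumes "remove_border_strip t l m"
  obtains s where "s \<in> range (maya l)" "s - int t \<notin> range (maya l)"
    "range (maya m) = range (maya l) - {s} \<union> {s - int t}"
proof -
  obtain p q where pq: "strip_rows l m p q" using remove_border_strip_rows[OF assms] .
  have anti: "antimono l" "antimono m" and t: "card (diagram l - diagram m) = t"
    using assms by (auto simp: remove_border_strip_def is_partition_def)
  have "maya m q = maya l p - int t" using strip_rows_card[OF pq] t by simp
  then show ?thesis using strip_rows_maya[OF pq anti] that[of "maya l p"] by auto
qed

lemma remove_border_stripI:
  assumes l: "is_partition l" and m: "is_partition m" and s: "strip_rows l m p q"
    and t: "maya l p - maya m q = int t"
  shows "remove_border_strip t l m"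
proof -
  define D where "D = diagram l - diagram m"
  define E where "E = {(a, b). a \<in> D \<and> b \<in> D \<and> adjacent_cells a b}"
  have pq: "p \<le> q" and step: "\<And>i. p \<le> i \<Longrightarrow> i < q \<Longrightarrow> l (Suc i) = Suc (m i)"
    and out: "\<And>i. i < p \<or> q < i \<Longrightarrow> l i = m i" and lt: "\<And>i. p \<le> i \<Longrightarrow> i \<le> q \<Longrightarrow> m i < l i"
    using s by (auto simp: strip_rows_def)
  have anti: "antimono l" "antimono m" using l m by (auto simp: is_partition_def)
  have D: "(i, j) \<in> D \<longleftrightarrow> m i \<le> j \<and> j < l i" for i j
    by (auto simp: D_def diagram_def)
  have D_rows: "p \<le> i \<and> i \<le> q" if "(i, j) \<in> D" for i j
    using that out[of i] by (auto simp: D not_less[symmetric])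
  have le: "m i \<le> l i" for i
    using out[of i] lt[of i] by (cases "i < p \<or> q < i") auto
  have left: "((i, m i + k), (i, m i)) \<in> E\<^sup>*" if "m i + k < l i" for i k
    using that
  proof (induction k)
    case (Suc k)
    have "((i, m i + Suc k), (i, m i + k)) \<in> E"
      using Suc.prems by (simp add: E_def D adjacent_cells_def)
    moreover have "((i, m i + k), (i, m i)) \<in> E\<^sup>*" using Suc by simp
    ultimately show ?case by (rule converse_rtrancl_into_rtrancl)
  qed simp
  have left': "((i, j), (i, m i)) \<in> E\<^sup>*" if "(i, j) \<in> D" for i j
    using left[of i "j - m i"] that by (simp add: D)
  \<comment> \<open>The cell below the first cell of row \<open>i\<close> is the last cell of row
    \<open>i + 1\<close>; a walk to the left then reaches the first cell of that row.\<close>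
  have down: "((i, m i), (q, m q)) \<in> E\<^sup>*" if "i \<le> q" "p \<le> i" for i
    using that
  proof (induction rule: inc_induct)
    case (step i)
    have c: "l (Suc i) = Suc (m i)" using \<open>i < q\<close> \<open>p \<le> i\<close> s by (simp add: strip_rows_def)
    have "(Suc i, m i) \<in> D" using c antimonoD[OF anti(2), of i "Suc i"] by (simp add: D)
    moreover have "(i, m i) \<in> D" using lt[of i] step by (simp add: D)
    ultimately have "((i, m i), (Suc i, m i)) \<in> E" by (simp add: E_def adjacent_cells_def)
    then show ?case using left'[OF \<open>(Suc i, m i) \<in> D\<close>] step by (meson le_SucI converse_rtrancl_into_rtrancl rtrancl_trans)
  qed simp
  have to_end: "(c, (q, m q)) \<in> E\<^sup>*" if "c \<in> D" for c
  proof -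
    obtain i j where c: "c = (i, j)" by (cases c)
    show ?thesis using left'[of i j] down[of i] D_rows[of i j] that c by (auto intro: rtrancl_trans)
  qed
  have "sym E" by (auto simp: E_def sym_def adjacent_cells_def)
  then have "sym (E\<^sup>*)" by (rule sym_rtrancl)
  then have conn: "connected_cells D"
    unfolding connected_cells_def E_def[symmetric] using to_end by (meson rtrancl_trans symD)
  have nosq: "\<not> {(i, j), (i, Suc j), (Suc i, j), (Suc i, Suc j)} \<subseteq> D" for i j
  proof
    assume a: "{(i, j), (i, Suc j), (Suc i, j), (Suc i, Suc j)} \<subseteq> D"
    then have "p \<le> i" "i < q" using D_rows[of i j] D_rows[of "Suc i" j] by auto
    then show False using step[of i] a by (auto simp: D)
  qed
  have ne: "D \<noteq> {}" using lt[of p] pq D[of p "m p"] by auto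
  have "card D = t" using strip_rows_card[OF s] t by (simp add: D_def)
  then show ?thesis
    using l m le conn nosq ne
    unfolding remove_border_strip_def border_strip_def D_def[symmetric] diagram_subset_iff by blast
qed

text \<open>The bead \<open>maya l p\<close> has to move to the vacancy \<open>s\<close>. It jumps
  over the beads \<open>p + 1, ..., q\<close>, whose indices drop by one, and this dictates the rows
  of \<open>m\<close>: \<open>l (Suc i) - 1\<close> for \<open>p \<le> i < q\<close>, and in row
  \<open>q\<close> the length whose bead is \<open>s\<close>.\<close>

lemma maya_move_remove:
  assumes l: "is_partition l" and t: "t > 0" and p: "maya l p - int t \<notin> range (maya l)"
  obtains m where "remove_border_strip t l m"
proof -
  have anti: "antimono l" using l by (simp add: is_partition_def)
  define s where "s = maya l p - int t"
  define J where "J = {j. s < maya l j}"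
  have "j < l 0 + nat (- s)" if "j \<in> J" for j
    using that antimonoD[OF anti, of 0 j] by (auto simp: J_def maya_def)
  then have finJ: "finite J" by (meson finite_nat_set_iff_bounded)
  have pJ: "p \<in> J" using t by (simp add: J_def s_def)
  define q where "q = Max J"
  have qJ: "q \<in> J" unfolding q_def using finJ pJ by (intro Max_in) auto
  have pq: "p \<le> q" unfolding q_def using finJ pJ by simp
  have "Suc q \<notin> J" using Max_ge[OF finJ, of "Suc q"] by (auto simp: q_def)
  moreover have "maya l (Suc q) \<noteq> s" using p unfolding s_def by (metis rangeI)
  ultimately have q1: "maya l (Suc q) < s" by (simp add: J_def)
  \<comment> \<open>Solves \<open>maya m q = s\<close> for the part \<open>m q\<close>. Nothing is
    truncated, because the next bead \<open>maya l (Suc q)\<close>, which is at least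
    \<open>- q - 2\<close>, lies below \<open>s\<close>.\<close>
  define z where "z = nat (s + int q + 1)"
  have z: "int z = s + int q + 1" using q1 by (simp add: z_def maya_def)
  have zq: "z < l q" using qJ z by (simp add: J_def maya_def)
  have zSq: "l (Suc q) \<le> z" using q1 z by (simp add: maya_def)
  define m where "m i = (if p \<le> i \<and> i < q then l (Suc i) - 1 else if i = q then z else l i)" for i
  have dec: "l (Suc i) \<le> l i" for i using antimonoD[OF anti, of i "Suc i"] by simp
  have lq: "l q \<le> l i" if "i \<le> q" for i using antimonoD[OF anti that] .
  have step: "l (Suc i) = Suc (m i)" if "p \<le> i" "i < q" for i
    using that zq lq[of "Suc i"] by (simp add: m_def)
  have lt: "m i < l i" if "p \<le> i" "i \<le> q" for i
    using that zq step[of i] dec[of i] by (cases "i = q") (auto simp: m_def)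
  have sr: "strip_rows l m p q"
    unfolding strip_rows_def using pq step lt by (auto simp: m_def)
  have le: "m i \<le> l i" for i
    using lt[of i] by (cases "p \<le> i \<and> i \<le> q") (auto simp: m_def less_imp_le zq)
  have "m (Suc i) \<le> m i" for i
  proof -
    consider "Suc i < p \<or> q < i" | "Suc i = p" | "p \<le> i" "Suc i < q" | "p \<le> i" "Suc i = q" | "i = q"
      using pq by linarith
    then show ?thesis
    proof cases
      case 1
      then show ?thesis using dec[of i] pq by (auto simp: m_def)
    next
      case 2
      then have "m i = l i" using pq by (auto simp: m_def)
      then show ?thesis using le[of "Suc i"] dec[of i] by simp
    next
      case 3
      then show ?thesis using dec[of "Suc i"] by (simp add: m_def diff_le_mono)
    next
      case 4
      then have "Suc (m i) = l q" "m (Suc i) = z" using step[of i] by (auto simp: m_def)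
      then show ?thesis using zq by simp
    next
      case 5
      then show ?thesis using zSq by (simp add: m_def)
    qed
  qed
  then have "antimono m" by (simp add: antimono_iff_le_Suc)
  moreover have "{j. m j \<noteq> 0} \<subseteq> {j. l j \<noteq> 0}" using le by (metis (mono_tags) Collect_mono le_zero_eq)
  then have "finite {j. m j \<noteq> 0}" using l finite_subset by (auto simp: is_partition_def)
  ultimately have m: "is_partition m" by (simp add: is_partition_def)
  have "maya l p - maya m q = int t" using z by (simp add: m_def s_def maya_def)
  from remove_border_stripI[OF l m sr this] show ?thesis by (rule that)
qed

lemma is_t_core_iff_maya:
  assumes "t > 0"
  shows "is_t_core t l \<longleftrightarrow> is_partition l \<and> (\<forall>s\<in>range (maya l). s - int t \<in> range (maya l))"
proof -
  have "(\<exists>m. remove_border_strip t l m) \<longleftrightarrow> (\<exists>s\<in>range (maya l). s - int t \<notin> range (maya l))"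
    if "is_partition l"
    using remove_border_strip_maya[of t l] maya_move_remove[OF that assms] by (metis rangeE)
  then show ?thesis by (auto simp: is_t_core_def)
qed

section \<open>Cores, orthogonality and rank\<close>

lemma maya_tail:
  assumes "\<forall>j\<ge>N. l j = 0" "s < - int N"
  shows "s \<in> range (maya l)"
proof -
  have "N \<le> nat (- s - 1)" using assms by simp
  then have "maya l (nat (- s - 1)) = s" using assms by (simp add: maya_def)
  then show ?thesis by (metis rangeI)
qed

lemma maya_ge_iff:
  assumes "\<forall>j\<ge>N. l j = 0"
  shows "- int N \<le> maya l j \<longleftrightarrow> j < N"
  using assms by (cases "j < N") (auto simp: maya_def)

text \<open>Counting positions rather than indices makes the effect of replacing one bead immediate.
  The cutoff \<open>- N\<close> keeps exactly the first \<open>N\<close> beads once all later parts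
  vanish.\<close>

definition residue_count :: "nat \<Rightarrow> nat \<Rightarrow> (nat \<Rightarrow> nat) \<Rightarrow> nat \<Rightarrow> nat" where
  "residue_count t N l i = card {s \<in> range (maya l). - int N \<le> s \<and> s mod int t = int i}"

lemma finite_maya_ge:
  assumes "antimono l"
  shows "finite {s \<in> range (maya l). a \<le> s}"
proof (rule finite_subset)
  show "{s \<in> range (maya l). a \<le> s} \<subseteq> {a..maya l 0}"
  proof -
    have "maya l i \<le> maya l 0" for i
      using maya_strict_decreasing[OF assms, of 0 i] by (cases "i = 0") auto
    then show ?thesis by auto
  qed
qed simp

lemma residue_count_remove:
  assumes r: "remove_border_strip t l m" and N: "\<forall>j\<ge>N. l j = 0"
  shows "\<forall>j\<ge>N. m j = 0" "residue_count t N m i = residue_count t N l i"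
proof -
  have le: "\<And>i. m i \<le> l i" and anti: "antimono l" "antimono m"
    using r by (auto simp: remove_border_strip_def diagram_subset_iff is_partition_def)
  show "\<forall>j\<ge>N. m j = 0" using le N by (metis le_zero_eq)
  obtain s where s: "s \<in> range (maya l)" "s - int t \<notin> range (maya l)"
    "range (maya m) = range (maya l) - {s} \<union> {s - int t}"
    using remove_border_strip_maya[OF r] .
  \<comment> \<open>Everything below \<open>- N\<close> is occupied, so the vacancy that receives
    the bead is still within the counted range.\<close>
  have ge: "- int N \<le> s - int t" using maya_tail[OF N, of "s - int t"] s(2) by force
  let ?A = "\<lambda>l. {s \<in> range (maya l). - int N \<le> s \<and> s mod int t = int i}"
  have fin: "finite (?A l)" using finite_maya_ge[OF anti(1), of "- int N"] by (rule rev_finite_subset) auto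
  have mod: "(s - int t) mod int t = s mod int t" by simp
  show "residue_count t N m i = residue_count t N l i"
  proof (cases "s mod int t = int i")
    case True
    have "?A m = insert (s - int t) (?A l - {s})" using s ge mod True by auto
    moreover have "s \<in> ?A l" using s ge True by auto
    moreover have "s - int t \<notin> ?A l - {s}" using s by auto
    ultimately show ?thesis unfolding residue_count_def
      using fin card_Suc_Diff1[OF fin, of s] by simp
  next
    case False
    then have "?A m = ?A l" using s mod by auto
    then show ?thesis by (simp add: residue_count_def)
  qed
qed

lemma residue_count_removes:
  assumes "(remove_border_strip t)\<^sup>*\<^sup>* l m" and "\<forall>j\<ge>N. l j = 0"
  shows "(\<forall>j\<ge>N. m j = 0) \<and> residue_count t N m i = residue_count t N l i"
  using assms
proof (induction rule: rtranclp_induct)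
  case (step y z)
  then show ?case using residue_count_remove[OF step.hyps(2)] by auto
qed simp

text \<open>\<open>beta l N j\<close> and \<open>maya l j\<close> differ by \<open>N\<close>, a
  multiple of \<open>t\<close>, so their residues agree.\<close>

lemma beta_count_eq_residue_count:
  assumes anti: "antimono l" and N: "\<forall>j\<ge>N. l j = 0" and d: "t dvd N"
  shows "beta_count t l N i = residue_count t N l i"
proof -
  have beta: "int (beta l N j) = maya l j + int N" if "j < N" for j
    using that by (simp add: beta_def maya_def of_nat_diff)
  have mod: "beta l N j mod t = i \<longleftrightarrow> maya l j mod int t = int i" if "j < N" for j
  proof -
    have "int (beta l N j mod t) = (maya l j + int N) mod int t"
      using beta[OF that] by (simp add: zmod_int)
    also have "\<dots> = maya l j mod int t"
      using d by (auto elim!: dvdE)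
    finally show ?thesis by (metis of_nat_eq_iff)
  qed
  have "bij_betw (maya l) {j. j < N \<and> beta l N j mod t = i}
      {s \<in> range (maya l). - int N \<le> s \<and> s mod int t = int i}"
  proof (rule bij_betw_imageI)
    show "inj_on (maya l) {j. j < N \<and> beta l N j mod t = i}"
      using maya_eq_iff[OF anti] by (auto simp: inj_on_def)
    show "maya l ` {j. j < N \<and> beta l N j mod t = i}
      = {s \<in> range (maya l). - int N \<le> s \<and> s mod int t = int i}"
      using maya_ge_iff[OF N] mod by auto
  qed
  then show ?thesis by (simp add: beta_count_def residue_count_def bij_betw_same_card)
qed

text \<open>Call \<open>int i + int t * k\<close> level \<open>k\<close> of runner \<open>i\<close>.
  For a core the occupied levels of a runner are closed downwards, hence form a ray
  \<open>k < d\<close>. All levels below \<open>- n\<close> are occupied, so counting those from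
  \<open>- n\<close> on gives \<open>d + n\<close>.\<close>

lemma core_residues:
  assumes core: "is_t_core t c" and t: "t > 0" and N: "\<forall>j\<ge>t * n. c j = 0" and i: "i < t"
  shows "int i + int t * k \<in> range (maya c) \<longleftrightarrow> k < int (residue_count t (t * n) c i) - int n"
proof -
  have part: "is_partition c" and cl: "\<And>s. s \<in> range (maya c) \<Longrightarrow> s - int t \<in> range (maya c)"
    using core is_t_core_iff_maya[OF t] by auto
  have anti: "antimono c" using part by (simp add: is_partition_def)
  let ?e = "\<lambda>k. int i + int t * k"
  define K where "K = {k. ?e k \<in> range (maya c)}"
  have ge_iff: "- int (t * n) \<le> ?e k \<longleftrightarrow> - int n \<le> k" for k
  proof
    assume "- int n \<le> k"
    then have "int t * (- int n) \<le> int t * k" by (intro mult_left_mono) auto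
    then show "- int (t * n) \<le> ?e k" by simp
  next
    assume a: "- int (t * n) \<le> ?e k"
    show "- int n \<le> k"
    proof (rule ccontr)
      assume "\<not> - int n \<le> k"
      then have "int t * (k + 1) \<le> int t * (- int n)" by (intro mult_left_mono) auto
      then show False using a i by (simp add: algebra_simps)
    qed
  qed
  have A: "{s \<in> range (maya c). - int (t * n) \<le> s \<and> s mod int t = int i} = ?e ` {k \<in> K. - int n \<le> k}"
  proof (intro equalityI subsetI)
    fix s assume s: "s \<in> {s \<in> range (maya c). - int (t * n) \<le> s \<and> s mod int t = int i}"
    then have "s = ?e (s div int t)" by (metis (mono_tags, lifting) mem_Collect_eq mod_mult_div_eq)
    then show "s \<in> ?e ` {k \<in> K. - int n \<le> k}"
      using s ge_iff[of "s div int t"] by (intro image_eqI[of _ _ "s div int t"]) (auto simp: K_def)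
  next
    fix s assume "s \<in> ?e ` {k \<in> K. - int n \<le> k}"
    then obtain k where k: "s = ?e k" "k \<in> K" "- int n \<le> k" by blast
    have "s mod int t = int i" using i by (simp add: k(1))
    then show "s \<in> {s \<in> range (maya c). - int (t * n) \<le> s \<and> s mod int t = int i}"
      using k ge_iff[of k] by (simp add: K_def)
  qed
  have inj: "inj_on ?e X" for X using t by (auto simp: inj_on_def)
  have fin: "finite {k \<in> K. - int n \<le> k}"
  proof -
    have "finite (?e ` {k \<in> K. - int n \<le> k})"
      unfolding A[symmetric] using finite_maya_ge[OF anti, of "- int (t * n)"] by (rule rev_finite_subset) auto
    then show ?thesis using inj finite_imageD by blast
  qed
  have cnt: "residue_count t (t * n) c i = card {k \<in> K. - int n \<le> k}"
    unfolding residue_count_def A by (rule card_image[OF inj])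
  have low: "k \<in> K" if "k < - int n" for k
    using maya_tail[OF N, of "?e k"] ge_iff[of k] that by (auto simp: K_def)
  have dec: "k - 1 \<in> K" if "k \<in> K" for k
    using cl[of "?e k"] that by (simp add: K_def algebra_simps)
  have down: "k \<in> K" if "k' \<in> K" "k \<le> k'" for k k'
    using that(2,1) by (induction rule: int_le_induct) (auto intro: dec)
  \<comment> \<open>If no level from \<open>- n\<close> on is occupied, the ray still contains
    everything below \<open>- n\<close>, which forces \<open>d = - n\<close>.\<close>
  define d where "d = (if {k \<in> K. - int n \<le> k} = {} then - int n else Max {k \<in> K. - int n \<le> k} + 1)"
  have d: "k \<in> K \<longleftrightarrow> k < d" for k
  proof (cases "{k \<in> K. - int n \<le> k} = {}")
    case True
    then show ?thesis using low[of k] by (auto simp: d_def not_le)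
  next
    case False
    then have mx: "Max {k \<in> K. - int n \<le> k} \<in> K" "- int n \<le> Max {k \<in> K. - int n \<le> k}"
      using Max_in[OF fin] by auto
    have d_eq: "d = Max {k \<in> K. - int n \<le> k} + 1" unfolding d_def using False by (simp only: if_False)
    show ?thesis
    proof
      assume "k \<in> K"
      then have "k \<le> Max {k \<in> K. - int n \<le> k}"
        using mx Max_ge[OF fin, of k] by (cases "- int n \<le> k") auto
      then show "k < d" using d_eq by simp
    next
      assume "k < d"
      then have "k \<le> Max {k \<in> K. - int n \<le> k}" using d_eq by simp
      then show "k \<in> K" by (rule down[OF mx(1)])
    qed
  qed
  have "d \<ge> - int n" using d[of "d - 1"] d[of "- int n - 1"] low[of "- int n - 1"] by simp
  moreover have "{k \<in> K. - int n \<le> k} = {- int n..<d}"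
    by (rule Set.set_eqI) (simp only: mem_Collect_eq d atLeastLessThan_iff conj_commute)
  ultimately have "int (residue_count t (t * n) c i) = d + int n" using cnt by simp
  then show ?thesis using d[of k] by (simp add: K_def)
qed

lemma t_core_exists:
  assumes "is_partition l" "t > 0"
  shows "\<exists>c. (remove_border_strip t)\<^sup>*\<^sup>* l c \<and> is_t_core t c"
  using assms(1)
proof (induction "card (diagram l)" arbitrary: l rule: less_induct)
  case less
  show ?case
  proof (cases "is_t_core t l")
    case False
    then obtain m where m: "remove_border_strip t l m" using less.prems by (auto simp: is_t_core_def)
    then have "diagram m \<subset> diagram l" "is_partition m"
      by (auto simp: remove_border_strip_def border_strip_def)
    then have "card (diagram m) < card (diagram l)"
      using finite_diagram[OF less.prems] by (intro psubset_card_mono)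
    then obtain c where "(remove_border_strip t)\<^sup>*\<^sup>* m c" "is_t_core t c"
      using less.hyps \<open>is_partition m\<close> by blast
    then show ?thesis using m by (meson converse_rtranclp_into_rtranclp)
  qed auto
qed

text \<open>Removals keep the residue counts, and these fix the bead set of a core, so all cores
  reachable from \<open>l\<close> coincide. This gives meaning to the definite description in
  \<open>t_core\<close>.\<close>

lemma t_core_properties:
  assumes l: "is_partition l" and t: "t > 0" and N: "\<forall>j\<ge>t * n. l j = 0"
  shows "is_t_core t (t_core t l)"
    and "i < t \<Longrightarrow> int i + int t * k \<in> range (maya (t_core t l)) \<longleftrightarrow>
           k < int (beta_count t l (t * n) i) - int n"
proof -
  have anti: "antimono l" using l by (simp add: is_partition_def)
  have key: "int i + int t * k \<in> range (maya c) \<longleftrightarrow> k < int (beta_count t l (t * n) i) - int n"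
    if c: "(remove_border_strip t)\<^sup>*\<^sup>* l c" "is_t_core t c" "i < t" for c i k
    using core_residues[OF c(2) t _ c(3), of n k] residue_count_removes[OF c(1) N, of i]
      beta_count_eq_residue_count[OF anti N, of t i] by simp
  have uniq: "c = c'" if c: "(remove_border_strip t)\<^sup>*\<^sup>* l c" "is_t_core t c"
    "(remove_border_strip t)\<^sup>*\<^sup>* l c'" "is_t_core t c'" for c c'
  proof (rule maya_range_inject)
    show "antimono c" "antimono c'" using c by (auto simp: is_t_core_def is_partition_def)
    show "range (maya c) = range (maya c')"
    proof (rule Set.set_eqI)
      fix s :: int
      define i where "i = nat (s mod int t)"
      have i: "i < t" "int i = s mod int t" using t by (auto simp: i_def nat_less_iff)
      have "s = int i + int t * (s div int t)" using i by simp
      then show "s \<in> range (maya c) \<longleftrightarrow> s \<in> range (maya c')"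
        using key[OF c(1,2) i(1), of "s div int t"] key[OF c(3,4) i(1), of "s div int t"] by simp
    qed
  qed
  have "(remove_border_strip t)\<^sup>*\<^sup>* l (t_core t l) \<and> is_t_core t (t_core t l)"
  proof -
    obtain c where c: "(remove_border_strip t)\<^sup>*\<^sup>* l c" "is_t_core t c"
      using t_core_exists[OF l t] by blast
    have "t_core t l = c"
      unfolding t_core_def by (rule the_equality) (use c uniq in auto)
    then show ?thesis using c by simp
  qed
  then show "is_t_core t (t_core t l)"
    and "i < t \<Longrightarrow> int i + int t * k \<in> range (maya (t_core t l)) \<longleftrightarrow>
           k < int (beta_count t l (t * n) i) - int n"
    using key by auto
qed

section \<open>Vacancies, Frobenius coordinates and the rank\<close>

lemma less_conjugate_iff:
  assumes "is_partition l"
  shows "i < conjugate l j \<longleftrightarrow> j < l i"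
proof -
  have anti: "antimono l" using assms by (simp add: is_partition_def)
  have "{i. j < l i} \<subseteq> {i. l i \<noteq> 0}" by auto
  then have fin: "finite {i. j < l i}" using assms finite_subset by (auto simp: is_partition_def)
  have down: "j < l i'" if "j < l i" "i' \<le> i" for i i'
    using that antimonoD[OF anti that(2)] by simp
  show ?thesis
  proof
    assume "j < l i"
    then have "{..i} \<subseteq> {i. j < l i}" using down by auto
    then have "card {..i} \<le> conjugate l j" unfolding conjugate_def by (rule card_mono[OF fin])
    then show "i < conjugate l j" by simp
  next
    assume a: "i < conjugate l j"
    show "j < l i"
    proof (rule ccontr)
      assume "\<not> j < l i"
      then have "{i. j < l i} \<subseteq> {..<i}" using down by (auto simp: not_less[symmetric] simp del: not_less)
      then have "conjugate l j \<le> card {..<i}" unfolding conjugate_def by (intro card_mono) auto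
      then show False using a by simp
    qed
  qed
qed

text \<open>Along the boundary of the diagram, vertical steps are beads and horizontal steps are
  vacancies, one for each column. If \<open>i\<close> beads lie above the vacancy \<open>s\<close>,
  then column \<open>j = s + i\<close> has height exactly \<open>i\<close>.\<close>

lemma not_in_maya_iff:
  assumes "is_partition l"
  shows "s \<notin> range (maya l) \<longleftrightarrow> (\<exists>j. s = int j - int (conjugate l j))"
proof
  note c = less_conjugate_iff[OF assms]
  have anti: "antimono l" using assms by (simp add: is_partition_def)
  assume s: "s \<notin> range (maya l)"
  obtain M where M: "\<And>j. M \<le> j \<Longrightarrow> l j = 0" using partition_bounded[OF assms] by blast
  have ex: "maya l (M + nat (- s)) < s" using M by (simp add: maya_def)
  define i where "i = (LEAST i. maya l i < s)"
  have i: "maya l i < s" unfolding i_def by (rule LeastI[of "\<lambda>i. maya l i < s", OF ex])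
  have below: "s < maya l i'" if "i' < i" for i'
    using not_less_Least[of i' "\<lambda>i. maya l i < s"] that s unfolding i_def
    by (metis linorder_neqE_linordered_idom rangeI)
  define j where "j = nat (s + int i)"
  have j: "int j = s + int i" using i by (simp add: j_def maya_def)
  have "l i \<le> j" using i j by (simp add: maya_def)
  then have "conjugate l j \<le> i" using c[of i j] by simp
  moreover have "i \<le> conjugate l j"
  proof (cases i)
    case (Suc i')
    then have "j < l i'" using below[of i'] j by (simp add: maya_def)
    then show ?thesis using c[of i' j] Suc by simp
  qed simp
  ultimately show "\<exists>j. s = int j - int (conjugate l j)" using j by (intro exI[of _ j]) simp
next
  note c = less_conjugate_iff[OF assms]
  assume "\<exists>j. s = int j - int (conjugate l j)"
  then obtain j where j: "s = int j - int (conjugate l j)" by blast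
  show "s \<notin> range (maya l)"
  proof
    assume "s \<in> range (maya l)"
    then obtain i where "s = int (l i) - int i - 1" by (auto simp: maya_def)
    then show False using j c[of i j] by (cases "j < l i") auto
  qed
qed

lemma less_partition_rank_iff:
  assumes "is_partition l"
  shows "i < partition_rank l \<longleftrightarrow> i < l i"
proof -
  have anti: "antimono l" using assms by (simp add: is_partition_def)
  let ?P = "\<lambda>k. k = 0 \<or> k \<le> l (k - 1)"
  have bd: "k \<le> l 0" if "?P k" for k using that antimonoD[OF anti, of 0 "k - 1"] by auto
  have P: "?P (partition_rank l)"
    unfolding partition_rank_def by (rule GreatestI_nat[of ?P 0 "l 0"]) (use bd in auto)
  show ?thesis
  proof
    assume i: "i < partition_rank l"
    then have "l (partition_rank l - 1) \<le> l i" by (intro antimonoD[OF anti]) simp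
    then show "i < l i" using P i by simp
  next
    assume "i < l i"
    then have "Suc i \<le> partition_rank l"
      unfolding partition_rank_def by (intro Greatest_le_nat[of ?P _ "l 0"]) (use bd in auto)
    then show "i < partition_rank l" by simp
  qed
qed

lemma maya_nonneg_iff:
  assumes "is_partition l"
  shows "0 \<le> maya l i \<longleftrightarrow> i < partition_rank l"
  using less_partition_rank_iff[OF assms, of i] by (auto simp: maya_def)

text \<open>The nonnegative beads are the arms, and the negative vacancies are the numbers
  \<open>- h i\<close>, where \<open>h i\<close> is the leg plus one. Leg = arm - 1 therefore says
  that the decreasing sequences \<open>maya l\<close> and \<open>h\<close> agree below the rank,
  which amounts to equality of their sets of values. Position 0 is vacant because \<open>h\<close>
  is positive there.\<close>

lemma orthogonal_partition_iff_maya: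
  assumes l: "is_partition l"
  shows "orthogonal_partition l \<longleftrightarrow>
    0 \<notin> range (maya l) \<and> (\<forall>a>0. a \<in> range (maya l) \<longleftrightarrow> - a \<notin> range (maya l))"
proof -
  have anti: "antimono l" using l by (simp add: is_partition_def)
  note c = less_conjugate_iff[OF l] and rk = less_partition_rank_iff[OF l]
  define r where "r = partition_rank l"
  define h where "h j = int (conjugate l j) - int j" for j
  have hpos: "0 < h j \<longleftrightarrow> j < r" for j using c[of j j] rk[of j] by (auto simp: h_def r_def)
  have nonneg: "0 \<le> maya l i \<longleftrightarrow> i < r" for i using maya_nonneg_iff[OF l] by (simp add: r_def)
  have pos_in: "a \<in> range (maya l) \<longleftrightarrow> a \<in> maya l ` {..<r}" if "0 \<le> a" for a
    using that nonneg by auto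
  have neg_out: "- a \<notin> range (maya l) \<longleftrightarrow> a \<in> h ` {..<r}" if "0 < a" for a
  proof -
    have "- a \<notin> range (maya l) \<longleftrightarrow> (\<exists>j. a = h j)"
      unfolding not_in_maya_iff[OF l] h_def by (metis minus_diff_eq minus_equation_iff)
    also have "\<dots> \<longleftrightarrow> a \<in> h ` {..<r}" using that hpos by auto
    finally show ?thesis .
  qed
  have orth: "orthogonal_partition l \<longleftrightarrow> (\<forall>i<r. h i = maya l i)"
    using l by (auto simp: orthogonal_partition_def frob_leg_def frob_arm_def r_def h_def maya_def)
  show ?thesis
  proof
    assume "orthogonal_partition l"
    then have eq: "\<And>i. i < r \<Longrightarrow> h i = maya l i" using orth by auto
    have im: "h ` {..<r} = maya l ` {..<r}" using eq by (intro image_cong) auto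
    have "0 \<notin> range (maya l)" using pos_in[of 0] im hpos by (metis imageE lessThan_iff less_irrefl order_refl)
    moreover have "a \<in> range (maya l) \<longleftrightarrow> - a \<notin> range (maya l)" if "a > 0" for a
      using pos_in[of a] neg_out[of a] im that by simp
    ultimately show "0 \<notin> range (maya l) \<and> (\<forall>a>0. a \<in> range (maya l) \<longleftrightarrow> - a \<notin> range (maya l))"
      by blast
  next
    assume a: "0 \<notin> range (maya l) \<and> (\<forall>a>0. a \<in> range (maya l) \<longleftrightarrow> - a \<notin> range (maya l))"
    have pos: "0 < maya l i" if "i < r" for i
      using nonneg[of i] that a by (metis order_le_less rangeI)
    have im: "h ` {..<r} = maya l ` {..<r}"
    proof (intro equalityI subsetI)
      fix y assume y: "y \<in> h ` {..<r}"
      then have "0 < y" using hpos by auto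
      then show "y \<in> maya l ` {..<r}" using neg_out[of y] pos_in[of y] y a by auto
    next
      fix y assume y: "y \<in> maya l ` {..<r}"
      then have "0 < y" using pos by auto
      then show "y \<in> h ` {..<r}" using neg_out[of y] pos_in[of y] y a by auto
    qed
    have h_dec: "h j < h i" if "i < j" for i j
    proof -
      have "conjugate l j \<le> conjugate l i"
        using c[of "conjugate l i" j] c[of "conjugate l i" i] that by (simp add: not_less[symmetric])
      then show ?thesis using that by (simp add: h_def)
    qed
    have "h i = maya l i" if "i < r" for i
      by (rule decreasing_enumeration_unique[of "{..<r}"])
        (use that im h_dec maya_strict_decreasing[OF anti] in auto)
    then show "orthogonal_partition l" using orth by simp
  qed
qed

text \<open>Negation maps level \<open>k\<close> of runner \<open>i\<close> to level
  \<open>- k - 1\<close> of runner \<open>t - i\<close>, and level \<open>k\<close> of runner 0 to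
  level \<open>- k\<close>. Every runner is filled exactly below \<open>d i\<close>, so the symmetry
  becomes a relation between end points.\<close>

lemma orthogonal_iff_residues:
  fixes d :: "nat \<Rightarrow> int"
  assumes l: "is_partition l" and t: "t > 0"
    and d: "\<And>i k. i < t \<Longrightarrow> int i + int t * k \<in> range (maya l) \<longleftrightarrow> k < d i"
  shows "orthogonal_partition l \<longleftrightarrow> d 0 = 0 \<and> (\<forall>i. 0 < i \<and> i < t \<longrightarrow> d i + d (t - i) = 0)"
proof -
  let ?S = "range (maya l)"
  have d0: "int t * k \<in> ?S \<longleftrightarrow> k < d 0" for k using d[of 0 k] t by simp
  have refl: "- (int i + int t * k) \<in> ?S \<longleftrightarrow> - k - 1 < d (t - i)" if "0 < i" "i < t" for i k
  proof -
    have eq: "- (int i + int t * k) = int (t - i) + int t * (- k - 1)"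
      using that by (simp add: of_nat_diff algebra_simps)
    show ?thesis unfolding eq by (rule d) (use that in simp)
  qed
  show ?thesis
    unfolding orthogonal_partition_iff_maya[OF l]
  proof
    assume a: "0 \<notin> ?S \<and> (\<forall>a>0. a \<in> ?S \<longleftrightarrow> - a \<notin> ?S)"
    have sym: "a \<in> ?S \<longleftrightarrow> - a \<notin> ?S" if "a \<noteq> 0" for a
      using a that by (cases "a > 0") (auto dest: spec[of _ "- a"])
    have "d 0 \<le> 0" using a d0[of 0] by simp
    \<comment> \<open>Position \<open>t\<close> is vacant, so its mirror image \<open>- t\<close> is
      occupied.\<close>
    moreover have "- 1 < d 0"
      using sym[of "int t * (- 1)"] d0[of "- 1"] d0[of 1] \<open>d 0 \<le> 0\<close> t by simp
    ultimately have "d 0 = 0" by simp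
    moreover have "d i + d (t - i) = 0" if i: "0 < i" "i < t" for i
    proof -
      have nz: "int i + int t * k \<noteq> 0" for k
      proof
        assume "int i + int t * k = 0"
        then have "int t dvd int i" by (metis dvd_add_times_triv_right_iff dvd_0_right mult.commute)
        then show False using i by (auto dest: zdvd_imp_le)
      qed
      have "k < d i \<longleftrightarrow> \<not> - k - 1 < d (t - i)" for k
        using d[OF i(2), of k] sym[OF nz, of k] refl[OF i, of k] by simp
      \<comment> \<open>The two instances give the two inequalities between \<open>d (t - i)\<close>
        and \<open>- d i\<close>.\<close>
      from this[of "d i"] this[of "d i - 1"] show ?thesis by simp
    qed
    ultimately show "d 0 = 0 \<and> (\<forall>i. 0 < i \<and> i < t \<longrightarrow> d i + d (t - i) = 0)" by simp
  next
    assume a: "d 0 = 0 \<and> (\<forall>i. 0 < i \<and> i < t \<longrightarrow> d i + d (t - i) = 0)"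
    have "0 \<notin> ?S" using d0[of 0] a by simp
    moreover have "s \<in> ?S \<longleftrightarrow> - s \<notin> ?S" if s: "s > 0" for s
    proof -
      define i where "i = nat (s mod int t)"
      define k where "k = s div int t"
      have i: "i < t" "int i = s mod int t" using t by (auto simp: i_def nat_less_iff)
      have sik: "s = int i + int t * k" using i by (simp add: k_def)
      show ?thesis
      proof (cases "i = 0")
        case True
        then have "s = int t * k" using sik by simp
        moreover have "k > 0" using s t \<open>s = int t * k\<close> by (simp add: zero_less_mult_iff)
        moreover have "- s = int t * (- k)" using \<open>s = int t * k\<close> by simp
        ultimately show ?thesis using d0[of k] d0[of "- k"] a by simp
      next
        case False
        then have "d i + d (t - i) = 0" using a i by auto
        then show ?thesis using d[OF i(1), of k] refl[of i k] False i unfolding sik by auto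
      qed
    qed
    ultimately show "0 \<notin> ?S \<and> (\<forall>a>0. a \<in> ?S \<longleftrightarrow> - a \<notin> ?S)" by blast
  qed
qed

text \<open>The rank is the number of nonnegative beads, and runner \<open>i\<close> carries those
  on the levels from 0 up to \<open>d i - 1\<close>.\<close>

lemma partition_rank_eq_sum:
  fixes d :: "nat \<Rightarrow> int"
  assumes l: "is_partition l" and t: "t > 0"
    and d: "\<And>i k. i < t \<Longrightarrow> int i + int t * k \<in> range (maya l) \<longleftrightarrow> k < d i"
  shows "partition_rank l = (\<Sum>i<t. nat (d i))"
proof -
  have anti: "antimono l" using l by (simp add: is_partition_def)
  have "maya l ` {..<partition_rank l} = {s \<in> range (maya l). 0 \<le> s}"
    using maya_nonneg_iff[OF l] by auto
  moreover have "card (maya l ` {..<partition_rank l}) = partition_rank l"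
    using maya_eq_iff[OF anti] by (subst card_image) (auto simp: inj_on_def)
  ultimately have rk: "partition_rank l = card {s \<in> range (maya l). 0 \<le> s}" by simp
  have "bij_betw (\<lambda>(i, k). int i + int t * k) (SIGMA i:{..<t}. {0..<d i}) {s \<in> range (maya l). 0 \<le> s}"
  proof (rule bij_betwI[where g = "\<lambda>s. (nat (s mod int t), s div int t)"])
    show "(\<lambda>s. (nat (s mod int t), s div int t)) \<in> {s \<in> range (maya l). 0 \<le> s} \<rightarrow> (SIGMA i:{..<t}. {0..<d i})"
    proof
      fix s assume s: "s \<in> {s \<in> range (maya l). 0 \<le> s}"
      have i: "nat (s mod int t) < t" "int (nat (s mod int t)) = s mod int t"
        using t by (auto simp: nat_less_iff)
      then have "s div int t < d (nat (s mod int t))"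
        using d[OF i(1), of "s div int t"] s by simp
      moreover have "0 \<le> s div int t" using s t by (simp add: pos_imp_zdiv_nonneg_iff)
      ultimately show "(nat (s mod int t), s div int t) \<in> (SIGMA i:{..<t}. {0..<d i})"
        using i by simp
    qed
  qed (use d t in \<open>auto simp: nat_less_iff\<close>)
  then have "partition_rank l = card (SIGMA i:{..<t}. {0..<d i})"
    unfolding rk by (rule bij_betw_same_card[symmetric])
  then show ?thesis by simp
qed

section \<open>Determinants over lists of rows and columns\<close>

text \<open>Labels replace indices: rows and columns are moved, reversed or sorted by rearranging a
  list, while the entry function stays the same.\<close>

definition list_det :: "('r \<Rightarrow> 'c \<Rightarrow> 'a::comm_ring_1) \<Rightarrow> 'r list \<Rightarrow> 'c list \<Rightarrow> 'a" where
  "list_det g u w = det (mat (length u) (length u) (\<lambda>(i, j). g (u ! i) (w ! j)))"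

lemma list_det_transpose:
  assumes "length u = length w"
  shows "list_det g u w = list_det (\<lambda>c r. g r c) w u"
proof -
  have "mat (length w) (length w) (\<lambda>(i, j). g (u ! j) (w ! i)) =
      transpose_mat (mat (length u) (length u) (\<lambda>(i, j). g (u ! i) (w ! j)))"
    using assms by (intro eq_matI) auto
  then show ?thesis
    unfolding list_det_def
    using det_transpose[of "mat (length u) (length u) (\<lambda>(i, j). g (u ! i) (w ! j))" "length u"]
    by simp
qed

lemma list_det_cong:
  assumes "length u = length w" "\<And>r c. r \<in> set u \<Longrightarrow> c \<in> set w \<Longrightarrow> g r c = h r c"
  shows "list_det g u w = list_det h u w"
  unfolding list_det_def using assms by (intro arg_cong[of _ _ det] eq_matI) auto

lemma list_det_map:
  assumes "length u = length w"
  shows "list_det g (map e u) (map f w) = list_det (\<lambda>r c. g (e r) (f c)) u w"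
  unfolding list_det_def using assms by (intro arg_cong[of _ _ det] eq_matI) auto

lemma list_det_scale_rows:
  assumes "length u = length w"
  shows "list_det (\<lambda>r c. a r * g r c) u w = prod_list (map a u) * list_det g u w"
proof -
  have "list_det (\<lambda>r c. a r * g r c) u w
      = (\<Prod>i = 0..<length u. a (u ! i)) * list_det g u w"
    unfolding list_det_def
    by (subst (1 2) det_def'[of _ "length u"])
      (auto simp: sum_distrib_left prod.distrib permutes_in_image algebra_simps intro!: sum.cong)
  also have "(\<Prod>i = 0..<length u. a (u ! i)) = prod_list (map a u)"
    by (simp add: prod.list_conv_set_nth)
  finally show ?thesis .
qed

lemma list_det_scale_cols:
  assumes "length u = length w"
  shows "list_det (\<lambda>r c. a c * g r c) u w = prod_list (map a w) * list_det g u w"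
  using assms list_det_scale_rows[of w u a "\<lambda>c r. g r c"]
  by (simp add: list_det_transpose[of u w])

lemma list_det_permute_cols:
  assumes "length u = length w" "p permutes {..<length w}"
  shows "list_det g u (map (\<lambda>k. w ! p k) [0..<length w]) = of_int (sign p) * list_det g u w"
proof -
  let ?N = "length w"
  let ?A = "mat ?N ?N (\<lambda>(i, j). g (u ! j) (w ! i))"
  have p: "p permutes {0..<?N}" using assms(2) by (simp add: atLeast0LessThan)
  have lt: "i < ?N \<Longrightarrow> p i < ?N" for i using permutes_in_image[OF p] by simp
  have "list_det g u (map (\<lambda>k. w ! p k) [0..<?N]) =
      det (mat ?N ?N (\<lambda>(i, j). ?A $$ (p i, j)))"
    using assms(1) lt
    by (subst list_det_transpose) (auto simp: list_det_def intro!: arg_cong[of _ _ det] eq_matI)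
  also have "\<dots> = of_int (sign p) * det ?A"
    by (subst det_permute_rows[OF _ p]) auto
  also have "det ?A = list_det g u w"
    using assms(1) by (subst list_det_transpose) (auto simp: list_det_def)
  finally show ?thesis .
qed

lemma list_det_swap_adjacent:
  assumes "length u = length (a @ x # y # b)"
  shows "list_det g u (a @ x # y # b) = - list_det g u (a @ y # x # b)"
proof -
  let ?w = "a @ x # y # b"
  let ?k = "length a"
  let ?p = "transpose ?k (Suc ?k)"
  have p: "?p permutes {..<length ?w}" by (rule permutes_swap_id) auto
  have "map (\<lambda>k. ?w ! ?p k) [0..<length ?w] = a @ y # x # b"
    proof (rule nth_equalityI)
    fix i assume i: "i < length (map (\<lambda>k. ?w ! ?p k) [0..<length ?w])"
    consider "i < ?k" | "i = ?k" | "i = Suc ?k" | m where "i = Suc (Suc (?k + m))"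
      by (metis less_natE linorder_neqE_nat not_less_eq_eq less_Suc_eq_le)
    then show "map (\<lambda>k. ?w ! ?p k) [0..<length ?w] ! i = (a @ y # x # b) ! i"
      using i by cases (auto simp: nth_append transpose_def simp del: upt_Suc)
  qed simp
  then show ?thesis
    using list_det_permute_cols[OF assms p, of g] by (simp add: sign_swap_id)
qed

lemma list_det_move:
  assumes "length u = length (a @ x # b @ c)"
  shows "list_det g u (a @ x # b @ c) = (- 1) ^ length b * list_det g u (a @ b @ x # c)"
  using assms
proof (induction b arbitrary: a)
  case (Cons y b)
  have "list_det g u (a @ x # y # b @ c) = - list_det g u ((a @ [y]) @ x # b @ c)"
    using Cons.prems by (subst list_det_swap_adjacent) auto
  also have "list_det g u ((a @ [y]) @ x # b @ c)
      = (- 1) ^ length b * list_det g u ((a @ [y]) @ b @ x # c)"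
    by (rule Cons.IH) (use Cons.prems in auto)
  finally show ?case by simp
qed simp

lemma list_det_swap_blocks:
  assumes "length u = length (a @ b @ c @ d)"
  shows "list_det g u (a @ b @ c @ d) = (- 1) ^ (length b * length c) * list_det g u (a @ c @ b @ d)"
  using assms
proof (induction b arbitrary: a)
  case (Cons x b)
  have "list_det g u (a @ (x # b) @ c @ d) = list_det g u ((a @ [x]) @ b @ c @ d)" by simp
  also have "\<dots> = (- 1) ^ (length b * length c) * list_det g u ((a @ [x]) @ c @ b @ d)"
    by (rule Cons.IH) (use Cons.prems in auto)
  also have "list_det g u ((a @ [x]) @ c @ b @ d)
      = (- 1) ^ length c * list_det g u (a @ c @ x # b @ d)"
    using list_det_move[of u a x c "b @ d" g] Cons.prems by simp
  finally show ?case by (simp add: power_add algebra_simps)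
qed simp

lemma list_det_rev:
  assumes "length u = length (a @ b @ c)"
  shows "list_det g u (a @ b @ c) = (- 1) ^ (length b choose 2) * list_det g u (a @ rev b @ c)"
  using assms
proof (induction b arbitrary: a)
  case (Cons x b)
  have "list_det g u (a @ (x # b) @ c) = list_det g u ((a @ [x]) @ b @ c)" by simp
  also have "\<dots> = (- 1) ^ (length b choose 2) * list_det g u ((a @ [x]) @ rev b @ c)"
    by (rule Cons.IH) (use Cons.prems in auto)
  also have "list_det g u ((a @ [x]) @ rev b @ c)
      = (- 1) ^ length b * list_det g u (a @ rev b @ x # c)"
    using list_det_move[of u a x "rev b" c g] Cons.prems by simp
  finally show ?case by (simp add: power_add algebra_simps numeral_2_eq_2)
qed (simp add: numeral_2_eq_2)

lemma list_det_swap_row_blocks: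
  assumes "length (a @ b @ c @ d) = length w"
  shows "list_det g (a @ b @ c @ d) w = (- 1) ^ (length b * length c) * list_det g (a @ c @ b @ d) w"
  using list_det_swap_blocks[of w a b c d "\<lambda>c r. g r c"] assms
  by (subst (1 2) list_det_transpose) auto

lemma list_det_block_diagonal:
  fixes g :: "'r \<Rightarrow> 'c \<Rightarrow> 'a::idom"
  assumes "length u = length w" "length u' = length w'"
    "\<And>r c. r \<in> set u \<Longrightarrow> c \<in> set w' \<Longrightarrow> g r c = 0"
  shows "list_det g (u @ u') (w @ w') = list_det g u w * list_det g u' w'"
proof -
  let ?n = "length u" and ?m = "length u'"
  have "mat (?n + ?m) (?n + ?m) (\<lambda>(i, j). g ((u @ u') ! i) ((w @ w') ! j)) =
      four_block_mat (mat ?n ?n (\<lambda>(i, j). g (u ! i) (w ! j))) (0\<^sub>m ?n ?m)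
        (mat ?m ?n (\<lambda>(i, j). g (u' ! i) (w ! j))) (mat ?m ?m (\<lambda>(i, j). g (u' ! i) (w' ! j)))"
    using assms by (intro eq_matI) (auto simp: nth_append)
  then show ?thesis
    unfolding list_det_def by (simp add: det_four_block_mat_upper_right_zero[of _ ?n _ ?m])
qed

text \<open>In a nonzero Leibniz term every row is matched with a column of its own class, so the
  permutation would restrict to a bijection between the rows in \<open>P\<close> and the columns in
  \<open>Q\<close>.\<close>

lemma list_det_class_mismatch:
  fixes g :: "'r \<Rightarrow> 'c \<Rightarrow> 'a::idom"
  assumes len: "length u = length w"
    and g: "\<And>r c. r \<in> set u \<Longrightarrow> c \<in> set w \<Longrightarrow> g r c \<noteq> 0 \<Longrightarrow> P r = Q c"
    and ne: "length (filter P u) \<noteq> length (filter Q w)"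
  shows "list_det g u w = 0"
proof -
  let ?N = "length u"
  have "(\<Prod>i = 0..<?N. g (u ! i) (w ! p i)) = 0" if p: "p permutes {0..<?N}" for p
  proof (rule ccontr)
    assume nz: "(\<Prod>i = 0..<?N. g (u ! i) (w ! p i)) \<noteq> 0"
    have lt: "i < ?N \<Longrightarrow> p i < ?N" for i using permutes_in_image[OF p] by simp
    have PQ: "P (u ! i) = Q (w ! p i)" if "i < ?N" for i
      using nz that lt[OF that] len by (intro g) auto
    have "p ` {i. i < ?N \<and> P (u ! i)} = {j. j < ?N \<and> Q (w ! j)}"
    proof (intro equalityI subsetI)
      fix j assume j: "j \<in> {j. j < ?N \<and> Q (w ! j)}"
      then obtain i where "i < ?N" "p i = j"
        using permutes_image[OF p] by (metis (mono_tags, lifting) atLeastLessThan_iff imageE mem_Collect_eq zero_le)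
      then show "j \<in> p ` {i. i < ?N \<and> P (u ! i)}" using j PQ by auto
    qed (use PQ lt in auto)
    moreover have "card (p ` {i. i < ?N \<and> P (u ! i)}) = card {i. i < ?N \<and> P (u ! i)}"
      by (rule card_image) (use permutes_inj[OF p] inj_on_subset in blast)
    ultimately show False
      using ne len by (simp add: length_filter_conv_card)
  qed
  then show ?thesis
    unfolding list_det_def by (subst det_def'[of _ ?N]) (auto intro!: sum.neutral)
qed

section \<open>The discrete Fourier transform of the row blocks\<close>

lemma sum_blocks:
  fixes f :: "nat \<Rightarrow> 'a::comm_monoid_add"
  shows "(\<Sum>i = 0..<t * n. f i) = (\<Sum>p<t. \<Sum>q<n. f (p * n + q))"
proof -
  have "(\<Sum>q<n. f (p * n + q)) = sum f {p * n..<p * n + n}" for p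
    using sum.shift_bounds_nat_ivl[of f 0 "p * n" n]
    by (simp add: atLeast0LessThan add.commute)
  then show ?thesis using sum.nat_group[of f n t] by (simp add: atLeast0LessThan)
qed

lemma primitive_root_power_mod:
  assumes "primitive_root_of_unity t w"
  shows "w ^ (a mod t) = w ^ a"
proof -
  have "w ^ a = (w ^ t) ^ (a div t) * w ^ (a mod t)"
    by (metis power_add power_mult mult_div_mod_eq)
  then show ?thesis using assms by (simp add: primitive_root_of_unity_def)
qed

lemma primitive_root_nonzero:
  assumes "primitive_root_of_unity t w" "t > 0"
  shows "w \<noteq> 0"
  using assms by (auto simp: primitive_root_of_unity_def power_0_left)

lemma primitive_root_power_eq_iff:
  assumes w: "primitive_root_of_unity t w" and t: "t > 0"
  shows "w ^ a = w ^ b \<longleftrightarrow> a mod t = b mod t"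
proof
  have "False" if "c < d" "d < t" "w ^ c = w ^ d" for c d
  proof -
    have "w ^ d = w ^ c * w ^ (d - c)" using that(1)
      by (metis power_add le_add_diff_inverse less_imp_le)
    then have "w ^ (d - c) = 1" using that primitive_root_nonzero[OF w t] by simp
    then show False using w that by (auto simp: primitive_root_of_unity_def)
  qed
  moreover assume "w ^ a = w ^ b"
  ultimately show "a mod t = b mod t"
    using primitive_root_power_mod[OF w] t by (metis linorder_neqE_nat mod_less_divisor)
qed (metis primitive_root_power_mod[OF w])

lemma sum_powers_root_of_unity:
  fixes z :: "'a::field"
  assumes "z ^ t = 1"
  shows "(\<Sum>p<t. z ^ p) = (if z = 1 then of_nat t else 0)"
  using assms geometric_sum[of z t] by auto

text \<open>
  Up to a factor \<open>t\<close>, the entry in row \<open>i mod n\<close> of block \<open>i div n\<close> after the Fourier transform.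
\<close>

definition folded_entry :: "nat \<Rightarrow> nat \<Rightarrow> (nat \<Rightarrow> 'a::field) \<Rightarrow> nat \<Rightarrow> nat \<Rightarrow> 'a" where
  "folded_entry t n x i c =
     (if c mod t = i div n then x (i mod n) powi int c else 0) +
     (if (c + i div n) mod t = 0 then x (i mod n) powi (- int c) else 0)"

definition sym_power :: "'a::field \<Rightarrow> nat \<Rightarrow> 'a" where
  "sym_power y c = y powi int c + y powi (- int c)"

text \<open>The factor \<open>D\<close> is the same for every column list \<open>w\<close>. It
  occurs in the numerator and in the denominator of the character and cancels, so only
  \<open>D \<noteq> 0\<close> has to be known about it.\<close>

lemma list_det_fourier:
  fixes \<omega> :: "'a::field_char_0"
  assumes \<omega>: "primitive_root_of_unity t \<omega>" and t: "t > 0" and n: "n > 0"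
  obtains D where "D \<noteq> 0"
    "\<And>w. length w = t * n \<Longrightarrow>
       D * list_det (\<lambda>i. sym_power (twisted_vars n \<omega> x i)) [0..<t * n] w
         = of_nat t ^ (t * n) * list_det (folded_entry t n x) [0..<t * n] w"
proof -
  let ?N = "t * n"
  have w0: "\<omega> \<noteq> 0" by (rule primitive_root_nonzero[OF \<omega> t])
  have wt: "(\<omega> ^ a) ^ t = 1" for a
    using \<omega> by (metis primitive_root_of_unity_def power_commutes power_mult power_one mult.commute)
  \<comment> \<open>\<open>F\<close> is the Fourier matrix of order \<open>t\<close>, with entries
    the powers \<open>- a * b\<close> of \<open>\<omega>\<close>, tensored with the identity of size
    \<open>n\<close>. \<open>F'\<close> is the same with \<open>\<omega>\<close> in place of its
    inverse; \<open>F * F'\<close> is \<open>t\<close> times the identity, which shows that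
    \<open>F\<close> is invertible.\<close>
  define F where "F = mat ?N ?N (\<lambda>(i, j). if i mod n = j mod n
     then inverse \<omega> ^ ((i div n) * (j div n)) else 0)"
  define F' where "F' = mat ?N ?N (\<lambda>(i, j). if i mod n = j mod n
     then \<omega> ^ ((i div n) * (j div n)) else 0)"
  have F: "F \<in> carrier_mat ?N ?N" and F': "F' \<in> carrier_mat ?N ?N"
    by (auto simp: F_def F'_def)
  have div_lt: "i div n < t" if "i < ?N" for i
    using that by (simp add: less_mult_imp_div_less)
  have F_mult: "(F * A) $$ (i, j) = (\<Sum>p<t. inverse \<omega> ^ ((i div n) * p) * A $$ (p * n + i mod n, j))"
    if "A \<in> carrier_mat ?N ?N" "i < ?N" "j < ?N" for A i j
  proof -
    have ltN: "p * n + q < t * n" if "p < t" "q < n" for p q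
      using that mult_le_mono1[of "Suc p" t n] by simp
    have "(F * A) $$ (i, j) = (\<Sum>k = 0..<?N. F $$ (i, k) * A $$ (k, j))"
      using that F by (auto simp: scalar_prod_def)
    also have "\<dots> = (\<Sum>p<t. \<Sum>q<n. F $$ (i, p * n + q) * A $$ (p * n + q, j))"
      by (rule sum_blocks)
    also have "\<dots> = (\<Sum>p<t. \<Sum>q<n. if i mod n = q
        then inverse \<omega> ^ ((i div n) * p) * A $$ (p * n + q, j) else 0)"
      using that ltN by (intro sum.cong refl) (auto simp: F_def)
    also have "\<dots> = (\<Sum>p<t. inverse \<omega> ^ ((i div n) * p) * A $$ (p * n + i mod n, j))"
      using n by (simp add: sum.delta)
    finally show ?thesis .
  qed
  \<comment> \<open>Orthogonality of characters: row block \<open>k\<close> keeps the power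
    \<open>c\<close> if \<open>c\<close> is congruent to \<open>k\<close> and, by the next fact, the
    power \<open>- c\<close> if \<open>c\<close> is congruent to \<open>- k\<close>.\<close>
  have sum1: "(\<Sum>p<t. inverse \<omega> ^ (k * p) * \<omega> ^ (p * c))
      = (if c mod t = k then of_nat t else 0)" if "k < t" for k c
  proof -
    have "(\<Sum>p<t. inverse \<omega> ^ (k * p) * \<omega> ^ (p * c)) = (\<Sum>p<t. (\<omega> ^ c / \<omega> ^ k) ^ p)"
      by (intro sum.cong refl)
        (simp add: divide_inverse power_mult_distrib mult.commute flip: power_mult power_inverse)
    also have "\<dots> = (if \<omega> ^ c / \<omega> ^ k = 1 then of_nat t else 0)"
      by (rule sum_powers_root_of_unity) (simp add: power_divide wt)
    also have "\<omega> ^ c / \<omega> ^ k = 1 \<longleftrightarrow> c mod t = k"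
      using primitive_root_power_eq_iff[OF \<omega> t, of c k] w0 that by simp
    finally show ?thesis .
  qed
  have sum2: "(\<Sum>p<t. inverse \<omega> ^ (k * p) * inverse \<omega> ^ (p * c))
      = (if (c + k) mod t = 0 then of_nat t else 0)" for k c
  proof -
    have "(\<Sum>p<t. inverse \<omega> ^ (k * p) * inverse \<omega> ^ (p * c)) = (\<Sum>p<t. (inverse \<omega> ^ (c + k)) ^ p)"
      by (intro sum.cong refl) (simp add: algebra_simps flip: power_add power_mult)
    also have "\<dots> = (if inverse \<omega> ^ (c + k) = 1 then of_nat t else 0)"
      by (rule sum_powers_root_of_unity) (simp add: power_inverse wt)
    also have "inverse \<omega> ^ (c + k) = 1 \<longleftrightarrow> (c + k) mod t = 0"
      using primitive_root_power_eq_iff[OF \<omega> t, of "c + k" 0] by (simp add: power_inverse)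
    finally show ?thesis .
  qed
  have blk: "(p * n + i mod n) div n = p" "(p * n + i mod n) mod n = i mod n" for p i
    using n by auto
  have ltN: "p * n + i mod n < t * n" if "p < t" for p i
    using that mult_le_mono1[of "Suc p" t n] mod_less_divisor[OF n, of i] by simp
  have "F * F' = of_nat t \<cdot>\<^sub>m 1\<^sub>m ?N"
  proof (rule eq_matI)
    fix i j assume "i < dim_row (of_nat t \<cdot>\<^sub>m 1\<^sub>m ?N :: 'a mat)" "j < dim_col (of_nat t \<cdot>\<^sub>m 1\<^sub>m ?N :: 'a mat)"
    then have ij: "i < ?N" "j < ?N" by auto
    have "(F * F') $$ (i, j) = (\<Sum>p<t. inverse \<omega> ^ ((i div n) * p) *
        (if i mod n = j mod n then \<omega> ^ (p * (j div n)) else 0))"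
      using ij ltN by (subst F_mult[OF F' ij]) (auto simp: F'_def blk intro!: sum.cong)
    also have "\<dots> = (if i mod n = j mod n \<and> i div n = j div n then of_nat t else 0)"
      using sum1[OF div_lt[OF ij(1)], of "j div n"] div_lt[OF ij(2)]
      by (cases "i mod n = j mod n") auto
    also have "\<dots> = (of_nat t \<cdot>\<^sub>m 1\<^sub>m ?N) $$ (i, j)"
      using ij by auto (metis div_mult_mod_eq)
    finally show "(F * F') $$ (i, j) = (of_nat t \<cdot>\<^sub>m 1\<^sub>m ?N) $$ (i, j)" .
  qed (auto simp: F_def F'_def)
  then have "det F * det F' = of_nat t ^ ?N"
    using det_mult[OF F F'] by simp
  then have "det F \<noteq> 0" using t by auto
  moreover have "det F * list_det (\<lambda>i. sym_power (twisted_vars n \<omega> x i)) [0..<?N] w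
      = of_nat t ^ ?N * list_det (folded_entry t n x) [0..<?N] w" if w: "length w = ?N" for w
  proof -
    let ?M = "mat ?N ?N (\<lambda>(i, j). sym_power (twisted_vars n \<omega> x i) (w ! j))"
    let ?G = "mat ?N ?N (\<lambda>(i, j). folded_entry t n x i (w ! j))"
    have M: "?M \<in> carrier_mat ?N ?N" by simp
    have "F * ?M = of_nat t \<cdot>\<^sub>m ?G"
    proof (rule eq_matI)
      fix i j assume "i < dim_row (of_nat t \<cdot>\<^sub>m ?G)" "j < dim_col (of_nat t \<cdot>\<^sub>m ?G)"
      then have ij: "i < ?N" "j < ?N" by auto
      define y c where "y = x (i mod n)" and "c = w ! j"
      have "(F * ?M) $$ (i, j) = (\<Sum>p<t. inverse \<omega> ^ ((i div n) * p) *
          sym_power (\<omega> ^ p * y) c)"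
        using ij ltN by (subst F_mult[OF M ij]) (auto simp: twisted_vars_def blk y_def c_def n intro!: sum.cong)
      also have "\<dots> = (\<Sum>p<t. inverse \<omega> ^ ((i div n) * p) * \<omega> ^ (p * c)) * y powi int c
          + (\<Sum>p<t. inverse \<omega> ^ ((i div n) * p) * inverse \<omega> ^ (p * c)) * y powi (- int c)"
        unfolding sym_power_def sum_distrib_right
        by (subst sum.distrib[symmetric], rule sum.cong)
          (auto simp: power_int_minus power_mult_distrib algebra_simps power_inverse simp flip: power_mult)
      also have "\<dots> = of_nat t * folded_entry t n x i c"
        by (subst sum1[OF div_lt[OF ij(1)]], subst sum2)
          (auto simp: folded_entry_def y_def algebra_simps)
      finally show "(F * ?M) $$ (i, j) = (of_nat t \<cdot>\<^sub>m ?G) $$ (i, j)"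
        using ij by (simp add: c_def)
    qed (auto simp: F_def)
    then have "det F * det ?M = of_nat t ^ ?N * det ?G"
      using det_mult[OF F M] by simp
    moreover have "mat ?N ?N (\<lambda>(i, j). sym_power (twisted_vars n \<omega> x ([0..<?N] ! i)) (w ! j)) = ?M"
      "mat ?N ?N (\<lambda>(i, j). folded_entry t n x ([0..<?N] ! i) (w ! j)) = ?G"
      by (auto intro!: eq_matI)
    ultimately show ?thesis by (simp add: list_det_def)
  qed
  ultimately show ?thesis using that by blast
qed

text \<open>The head \<open>h i\<close> passes the blocks \<open>C 0, ..., C (i - 1)\<close>, each
  of length \<open>n\<close>; summing \<open>n * i\<close> over \<open>i < m\<close> gives the
  exponent.\<close>

lemma list_det_interleave_heads:
  assumes "length u = length (a @ concat (map (\<lambda>i. h i # C i) [0..<m]) @ d)"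
    and "\<And>i. length (C i) = n"
  shows "list_det g u (a @ concat (map (\<lambda>i. h i # C i) [0..<m]) @ d)
    = (- 1) ^ (n * (m choose 2)) * list_det g u (a @ map h [0..<m] @ concat (map C [0..<m]) @ d)"
  using assms(1)
proof (induction m arbitrary: d)
  case 0
  then show ?case by (simp add: numeral_2_eq_2)
next
  case (Suc m)
  let ?c = "concat (map C [0..<m])"
  have len: "length ?c = m * n" "length (concat (map (\<lambda>i. h i # C i) [0..<m])) = m * Suc n"
    using assms(2) by (simp_all add: length_concat comp_def sum_list_triv)
  have "list_det g u (a @ concat (map (\<lambda>i. h i # C i) [0..<Suc m]) @ d)
      = (- 1) ^ (n * (m choose 2)) * list_det g u (a @ map h [0..<m] @ ?c @ (h m # C m @ d))"
    using Suc.IH[of "h m # C m @ d"] Suc.prems by simp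
  also have "list_det g u (a @ map h [0..<m] @ ?c @ (h m # C m @ d))
      = (- 1) ^ (m * n) * list_det g u ((a @ map h [0..<m]) @ [h m] @ ?c @ (C m @ d))"
    using list_det_swap_blocks[of u "a @ map h [0..<m]" ?c "[h m]" "C m @ d" g] Suc.prems len
    by (simp add: algebra_simps)
  finally show ?case
    by (simp add: power_add numeral_2_eq_2 algebra_simps)
qed

text \<open>The decreasing list is the beta set of the empty partition, so the power of -1 is the
  sign of sorting it by residues. The induction peels off the \<open>t\<close> largest entries:
  reversing them costs \<open>t choose 2\<close>, and placing one at the head of each class, behind
  which \<open>n\<close> entries are already sorted, costs \<open>n * (t choose 2)\<close>. The
  resulting multiples of \<open>t choose 2\<close> add up to the exponent.\<close>

lemma list_det_rev_upt:
  assumes "length u = length (a @ rev [0..<t * n])"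
  shows "list_det g u (a @ rev [0..<t * n]) = (- 1) ^ ((t choose 2) * (Suc n choose 2)) *
    list_det g u (a @ concat (map (\<lambda>i. map (\<lambda>b. t * b + i) (rev [0..<n])) [0..<t]))"
  using assms
proof (induction n arbitrary: a)
  case 0
  have "concat (map (\<lambda>i. map (\<lambda>b. t * b + i) (rev [0..<0])) [0..<t]) = []" by simp
  then show ?case by (simp only:) (simp add: numeral_2_eq_2)
next
  case (Suc n)
  let ?C = "\<lambda>n i. map (\<lambda>b. t * b + i) (rev [0..<n])"
  let ?h = "map (\<lambda>i. t * n + i) [0..<t]"
  let ?e = "(t choose 2) * (Suc n choose 2)"
  have h: "[t * n..<t * n + t] = ?h"
    by (rule nth_equalityI) auto
  have len: "length (concat (map (?C n) [0..<t])) = t * n"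
    by (simp add: length_concat comp_def sum_list_triv)
  have hd: "?C (Suc n) = (\<lambda>i. (t * n + i) # ?C n i)" by auto
  have len': "length (concat (map (\<lambda>i. (t * n + i) # ?C n i) [0..<t])) = t * Suc n"
    by (simp add: length_concat comp_def sum_list_triv)
  have rev_split: "rev [0..<t * Suc n] = rev ?h @ rev [0..<t * n]"
    using upt_add_eq_append[of 0 "t * n" t] h by (simp add: add.commute)
  have "list_det g u (a @ rev [0..<t * Suc n])
      = (- 1) ^ ?e * list_det g u (a @ rev ?h @ concat (map (?C n) [0..<t]))"
    unfolding rev_split using Suc.IH[of "a @ rev ?h"] Suc.prems by simp
  also have "list_det g u (a @ rev ?h @ concat (map (?C n) [0..<t]))
      = (- 1) ^ (t choose 2) * list_det g u (a @ ?h @ concat (map (?C n) [0..<t]))"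
    using list_det_rev[of u a "rev ?h" "concat (map (?C n) [0..<t])" g] Suc.prems len
    by simp
  also have "list_det g u (a @ ?h @ concat (map (?C n) [0..<t]))
      = (- 1) ^ (n * (t choose 2)) * list_det g u (a @ concat (map (?C (Suc n)) [0..<t]))"
  proof -
    have "list_det g u (a @ concat (map (?C (Suc n)) [0..<t]))
      = (- 1) ^ (n * (t choose 2)) * list_det g u (a @ ?h @ concat (map (?C n) [0..<t]))"
      unfolding hd
      using list_det_interleave_heads[of u a "\<lambda>i. t * n + i" "?C n" t "[]" n g] Suc.prems len'
      by simp
    then show ?thesis by (simp add: mult.assoc[symmetric] power_add[symmetric] mult_2[symmetric])
  qed
  also have "(- 1) ^ ?e * ((- 1) ^ (t choose 2) * ((- 1) ^ (n * (t choose 2)) *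
       list_det g u (a @ concat (map (?C (Suc n)) [0..<t]))))
     = (- 1) ^ (?e + (t choose 2) + n * (t choose 2)) *
       list_det g u (a @ concat (map (?C (Suc n)) [0..<t]))"
    by (simp add: power_add mult.assoc)
  also have "?e + (t choose 2) + n * (t choose 2) = (t choose 2) * (Suc (Suc n) choose 2)"
    by (simp add: numeral_2_eq_2 algebra_simps)
  finally show ?case .
qed

section \<open>Factorization over pairs of opposite residues\<close>

definition row_block :: "nat \<Rightarrow> nat \<Rightarrow> nat list" where
  "row_block n k = [k * n..<k * n + n]"

definition residue_cols :: "nat \<Rightarrow> nat \<Rightarrow> nat list \<Rightarrow> nat list" where
  "residue_cols t i bs = map (\<lambda>b. t * b + i) bs"

lemma length_row_block [simp]: "length (row_block n k) = n"
  by (simp add: row_block_def)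

lemma length_residue_cols [simp]: "length (residue_cols t i bs) = length bs"
  by (simp add: residue_cols_def)

lemma row_block_conv_map: "row_block n k = map (\<lambda>i. k * n + i) [0..<n]"
  by (rule nth_equalityI) (auto simp: row_block_def)

lemma div_row_block: "i \<in> set (row_block n k) \<Longrightarrow> i div n = k"
  by (auto simp: row_block_def mult.commute intro!: div_nat_eqI)

lemma mod_residue_cols: "c \<in> set (residue_cols t i bs) \<Longrightarrow> i < t \<Longrightarrow> c mod t = i"
  by (auto simp: residue_cols_def)

lemma folded_entry_eq_0:
  assumes "c mod t \<noteq> i div n" "(c mod t + i div n) mod t \<noteq> 0"
  shows "folded_entry t n x i c = 0"
  using assms by (auto simp: folded_entry_def mod_simps)

text \<open>Residue 0 is its own opposite, so both powers survive and recombine to a symmetric power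
  in \<open>x^t\<close>.\<close>

lemma list_det_zero_block:
  assumes "t > 0" "length bs = n"
  shows "list_det (folded_entry t n x) (row_block n 0) (residue_cols t 0 bs)
    = list_det (\<lambda>i. sym_power (x i ^ t)) [0..<n] bs"
proof -
  have "list_det (folded_entry t n x) (row_block n 0) (residue_cols t 0 bs)
      = list_det (\<lambda>i b. folded_entry t n x (0 * n + i) (t * b + 0)) [0..<n] bs"
    unfolding row_block_conv_map residue_cols_def using assms by (subst list_det_map) auto
  also have "\<dots> = list_det (\<lambda>i. sym_power (x i ^ t)) [0..<n] bs"
    using assms
    by (intro list_det_cong)
      (auto simp: folded_entry_def sym_power_def power_int_minus simp del: of_nat_mult simp flip: power_mult)
  finally show ?thesis .
qed

text \<open>With \<open>y = x^t\<close> the entry is \<open>x^(-h)\<close> times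
  \<open>y^(b+1) + y^(-b)\<close>. Passing from \<open>y\<close> to \<open>- y\<close> turns the
  plus into the minus of an odd orthogonal numerator and costs \<open>(-1)^(b+1)\<close> for each
  column. This is the origin of the variables \<open>-X^t\<close> and of the sign in front of that
  character.\<close>

lemma list_det_half_block:
  assumes t: "t = 2 * h" "h > 0" and len: "length bs = n" and x: "\<forall>i<n. x i \<noteq> 0"
  shows "list_det (folded_entry t n x) (row_block n h) (residue_cols t h bs)
    = prod_list (map (\<lambda>i. x i powi (- int h)) [0..<n]) * (- 1) ^ (sum_list bs + n) *
      list_det (\<lambda>i b. (- (x i ^ t)) powi (int b + 1) - (- (x i ^ t)) powi (- int b)) [0..<n] bs"
proof -
  let ?H = "\<lambda>i b. (- (x i ^ t)) powi (int b + 1) - (- (x i ^ t)) powi (- int b)"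
  have entry: "folded_entry t n x (h * n + i) (t * b + h)
      = x i powi (- int h) * ((- 1) ^ Suc b * ?H i b)" if i: "i < n" for i b
  proof -
    define y where "y = x i"
    have y: "y \<noteq> 0" using x i by (simp add: y_def)
    have d: "(h * n + i) div n = h" "(h * n + i) mod n = i" using i by auto
    have m: "(t * b + h) mod t = h" "(t * b + h + h) mod t = 0"
      using t by (auto simp: mult_2[symmetric] simp flip: distrib_left)
    have "folded_entry t n x (h * n + i) (t * b + h)
        = y powi (int (t * b + h)) + y powi (- int (t * b + h))"
      by (simp only: folded_entry_def d m y_def if_True simp_thms)
    also have "\<dots> = y powi (- int h) * ((y ^ t) powi (int b + 1) + (y ^ t) powi (- int b))"
    proof -
      have "y powi (int (t * b + h)) = y powi (- int h + int t * (int b + 1))"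
        using t by (simp add: algebra_simps)
      also have "\<dots> = y powi (- int h) * (y ^ t) powi (int b + 1)"
        using y by (subst power_int_add) (auto simp only: power_int_mult power_int_of_nat simp_thms)
      moreover have "y powi (- int (t * b + h)) = y powi (- int h + int t * (- int b))"
        by (simp add: algebra_simps)
      moreover have "\<dots> = y powi (- int h) * (y ^ t) powi (- int b)"
        using y by (subst power_int_add) (auto simp only: power_int_mult power_int_of_nat simp_thms)
      ultimately show ?thesis by (simp add: distrib_left)
    qed
    also have "(y ^ t) powi (int b + 1) + (y ^ t) powi (- int b) = (- 1) ^ Suc b * ?H i b"
    proof -
      have "(- (y ^ t)) powi (int b + 1) = (- 1) ^ Suc b * (y ^ t) powi (int b + 1)"
        using power_int_mult_distrib[of "- 1" "y ^ t" "int b + 1"]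
          power_int_of_nat[of "- 1 :: 'a" "Suc b"] by (simp add: add.commute)
      moreover have "(- (y ^ t)) powi (- int b) = (- 1) ^ b * (y ^ t) powi (- int b)"
        using power_int_mult_distrib[of "- 1" "y ^ t" "- int b"]
        by (simp add: power_int_minus flip: power_inverse)
      ultimately show ?thesis
        by (simp add: y_def algebra_simps flip: power_add mult_2)
    qed
    finally show ?thesis by (simp add: y_def)
  qed
  have "list_det (folded_entry t n x) (row_block n h) (residue_cols t h bs)
      = list_det (\<lambda>i b. folded_entry t n x (h * n + i) (t * b + h)) [0..<n] bs"
    unfolding row_block_conv_map residue_cols_def using len by (subst list_det_map) auto
  also have "\<dots> = list_det (\<lambda>i b. x i powi (- int h) * ((- 1) ^ Suc b * ?H i b)) [0..<n] bs"
    using len entry by (intro list_det_cong) auto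
  also have "\<dots> = prod_list (map (\<lambda>i. x i powi (- int h)) [0..<n]) *
      (prod_list (map (\<lambda>b. (- 1) ^ Suc b) bs) * list_det ?H [0..<n] bs)"
  proof -
    have l: "length [0..<n] = length bs" using len by simp
    show ?thesis by (simp only: list_det_scale_rows[OF l] list_det_scale_cols[OF l])
  qed
  also have "prod_list (map (\<lambda>b. (- 1 :: 'a) ^ Suc b) bs) = (- 1) ^ (sum_list bs + length bs)"
    by (induction bs) (auto simp: power_add)
  finally show ?thesis using len by (simp add: mult.assoc)
qed

text \<open>Encoding a column of residue \<open>t - k\<close> and quotient \<open>b\<close> as
  \<open>z = - b - 1\<close> makes all columns uniform: every entry in row block \<open>k\<close> is
  \<open>x^(k + t z)\<close>, and every entry in row block \<open>t - k\<close> is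
  \<open>x^(- k - t z)\<close>. Up to row factors these are powers of the \<open>2 * n\<close>
  variables. Reversing the second group of columns puts the exponents in the order of a Schur
  numerator.\<close>

lemma list_det_pair_block:
  fixes x :: "nat \<Rightarrow> 'a::field"
  assumes k: "0 < k" "2 * k < t" and len: "length bs + length cs = 2 * n"
    and x: "\<forall>i<n. x i \<noteq> 0"
  shows "list_det (folded_entry t n x) (row_block n k @ row_block n (t - k))
      (residue_cols t k bs @ residue_cols t (t - k) cs)
    = (- 1) ^ (length cs choose 2) *
      list_det (\<lambda>i e. power_inverse_vars t n x i powi e) [0..<2 * n]
        (map int bs @ map (\<lambda>b. - int b - 1) (rev cs))"
proof -
  let ?e = "\<lambda>i. if i < n then k * n + i else (t - k) * n + (i - n)"
  let ?f = "\<lambda>z::int. if z \<ge> 0 then t * nat z + k else t * nat (- z - 1) + (t - k)"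
  let ?a = "\<lambda>i. if i < n then x i powi int k else x (i - n) powi (- int k)"
  have rows: "row_block n k @ row_block n (t - k) = map ?e [0..<2 * n]"
    by (rule nth_equalityI) (auto simp: row_block_def nth_append)
  have cols: "residue_cols t k bs @ residue_cols t (t - k) cs
      = map ?f (map int bs @ map (\<lambda>b. - int b - 1) cs)"
    by (auto simp: residue_cols_def)
  have entry: "folded_entry t n x (?e i) (?f z) = ?a i * power_inverse_vars t n x i powi z"
    if i: "i < 2 * n" for i z
  proof (cases "i < n")
    case True
    then have d: "?e i div n = k" "?e i mod n = i" by auto
    define y where "y = x i"
    have y: "y \<noteq> 0" using x True by (simp add: y_def)
    have "folded_entry t n x (?e i) (?f z) = y powi (int k + int t * z)"
    proof (cases "z \<ge> 0")
      case z: True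
      have "?f z + k = (k + k) + t * nat z" using z by simp
      then have "(?f z + k) mod t = (k + k) mod t" by (simp only: mod_mult_self2)
      then have "(?f z + k) mod t \<noteq> 0" using k by simp
      moreover have "?f z mod t = k" using z k by simp
      moreover have "int (?f z) = int k + int t * z" using z by simp
      ultimately show ?thesis unfolding folded_entry_def d by (simp add: y_def)
    next
      case z: False
      have "?f z + k = t * nat (- z - 1) + t" using z k by simp
      then have "(?f z + k) mod t = 0" by simp
      moreover have "?f z = (t - k) + t * nat (- z - 1)" using z by simp
      then have "?f z mod t = t - k" using k by (simp only: mod_mult_self2) simp
      then have "?f z mod t \<noteq> k" using k by simp
      moreover have "- int (?f z) = int k + int t * z" using z k by (simp add: algebra_simps of_nat_diff)
      ultimately show ?thesis unfolding folded_entry_def d by (simp only: y_def) simp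
    qed
    also have "\<dots> = y powi int k * (y powi int t) powi z"
      using y by (subst power_int_add) (auto simp: power_int_mult)
    finally show ?thesis using True by (simp add: y_def power_inverse_vars_def)
  next
    case False
    have "(a * n + q) div n = a" "(a * n + q) mod n = q" if "q < n" for a q using that by auto
    note blk = this[of "i - n" "t - k"]
    have "i - n < n" using False i by simp
    with False have d: "?e i div n = t - k" "?e i mod n = i - n" by (simp_all only: blk if_False)
    define y where "y = x (i - n)"
    have y: "y \<noteq> 0" using x False i by (simp add: y_def)
    have "folded_entry t n x (?e i) (?f z) = y powi (- int k + (- int t) * z)"
    proof (cases "z \<ge> 0")
      case z: True
      have "?f z + (t - k) = t * nat z + t" using z k by simp
      then have "(?f z + (t - k)) mod t = 0" by simp
      moreover have "?f z mod t = k" using z k by simp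
      then have "?f z mod t \<noteq> t - k" using k by simp
      moreover have "- int (?f z) = - int k + (- int t) * z" using z by simp
      ultimately show ?thesis unfolding folded_entry_def d by (simp only: y_def) simp
    next
      case z: False
      have "?f z + (t - k) = t * nat (- z - 1) + t + (t - 2 * k)" using z k by simp
      then have "?f z + (t - k) = (t - 2 * k) + t * Suc (nat (- z - 1))" by simp
      then have "(?f z + (t - k)) mod t = t - 2 * k" using k by (simp only: mod_mult_self2) simp
      then have "(?f z + (t - k)) mod t \<noteq> 0" using k by simp
      moreover have "?f z = (t - k) + t * nat (- z - 1)" using z by simp
      then have "?f z mod t = t - k" using k by (simp only: mod_mult_self2) simp
      moreover have "int (?f z) = - int k + (- int t) * z"
        using z k by (simp add: algebra_simps of_nat_diff)
      ultimately show ?thesis unfolding folded_entry_def d by (simp only: y_def) simp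
    qed
    also have "\<dots> = y powi (- int k) * (y powi (- int t)) powi z"
      using y by (subst power_int_add) (auto simp only: power_int_mult simp_thms)
    finally show ?thesis using False by (simp add: y_def power_inverse_vars_def)
  qed
  \<comment> \<open>The factors \<open>x^k\<close> and \<open>x^(-k)\<close> of the two row blocks
    cancel in pairs.\<close>
  have prod1: "prod_list (map ?a [0..<2 * n]) = 1"
  proof -
    have "[0..<2 * n] = [0..<n] @ map (\<lambda>i. i + n) [0..<n]"
      by (simp add: map_add_upt mult_2 flip: upt_add_eq_append)
    then have "prod_list (map ?a [0..<2 * n])
        = prod_list (map (\<lambda>i. x i powi int k) [0..<n]) * prod_list (map (\<lambda>i. x i powi (- int k)) [0..<n])"
      by (simp only: map_append prod_list.append map_map comp_def)
        (intro arg_cong2[of _ _ _ _ "(*)"] arg_cong[of _ _ prod_list] map_cong; simp)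
    also have "\<dots> = 1"
      using x by (auto simp: prod.distinct_set_conv_list[symmetric] power_int_minus simp flip: prod.distrib)
    finally show ?thesis .
  qed
  let ?z = "map int bs @ map (\<lambda>b. - int b - 1) cs"
  have "list_det (folded_entry t n x) (row_block n k @ row_block n (t - k))
      (residue_cols t k bs @ residue_cols t (t - k) cs)
    = list_det (\<lambda>i z. folded_entry t n x (?e i) (?f z)) [0..<2 * n] ?z"
    unfolding rows cols using len by (subst list_det_map) auto
  also have "\<dots> = list_det (\<lambda>i z. ?a i * power_inverse_vars t n x i powi z) [0..<2 * n] ?z"
    using len by (intro list_det_cong entry) auto
  also have "\<dots> = list_det (\<lambda>i z. power_inverse_vars t n x i powi z) [0..<2 * n] ?z"
    using len by (subst list_det_scale_rows) (auto simp: prod1)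
  also have "\<dots> = (- 1) ^ (length cs choose 2) * list_det (\<lambda>i z. power_inverse_vars t n x i powi z) [0..<2 * n]
        (map int bs @ map (\<lambda>b. - int b - 1) (rev cs))"
    using list_det_rev[of "[0..<2 * n]" "map int bs" "map (\<lambda>b. - int b - 1) cs" "[]"] len
    by (simp add: rev_map)
  finally show ?thesis .
qed

section \<open>Peeling off pairs of opposite residues from the outside\<close>

definition inner_cols :: "nat \<Rightarrow> (nat \<Rightarrow> nat list) \<Rightarrow> nat \<Rightarrow> nat list" where
  "inner_cols t bs k = concat (map (\<lambda>i. residue_cols t i (bs i)) [k..<t + 1 - k])"

text \<open>Up to a common shift of the exponents, which are negative in the second group, this is
  the numerator of a Schur character in \<open>X^t\<close> and the inverse variables.\<close>

definition pair_factor :: "nat \<Rightarrow> nat \<Rightarrow> (nat \<Rightarrow> 'a::field) \<Rightarrow> (nat \<Rightarrow> nat list) \<Rightarrow> nat \<Rightarrow> 'a" where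
  "pair_factor t n x bs k = list_det (\<lambda>i e. power_inverse_vars t n x i powi e) [0..<2 * n]
     (map int (bs k) @ map (\<lambda>b. - int b - 1) (rev (bs (t - k))))"

text \<open>
  The product comes from moving row block \<open>t - k\<close> and column block \<open>t - k\<close> past everything strictly
  between \<open>k\<close> and \<open>t - k\<close>, the binomial coefficient from reversing the latter column block.
\<close>

definition pair_sign :: "nat \<Rightarrow> nat \<Rightarrow> (nat \<Rightarrow> nat list) \<Rightarrow> nat \<Rightarrow> nat" where
  "pair_sign t n bs k = (n + length (bs (t - k))) * ((t - 1 - 2 * k) * n)
     + (length (bs (t - k)) choose 2)"

definition middle_factor :: "nat \<Rightarrow> nat \<Rightarrow> (nat \<Rightarrow> 'a::field) \<Rightarrow> (nat \<Rightarrow> nat list) \<Rightarrow> 'a" where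
  "middle_factor t n x bs = (if even t
     then list_det (folded_entry t n x) (row_block n (t div 2)) (residue_cols t (t div 2) (bs (t div 2)))
     else 1)"

lemma inner_cols_split:
  assumes "2 * k < t"
  shows "inner_cols t bs k =
    residue_cols t k (bs k) @ inner_cols t bs (Suc k) @ residue_cols t (t - k) (bs (t - k))"
proof -
  have "[k..<t + 1 - k] = [k..<t - k] @ [t - k]"
    using assms upt_Suc_append[of k "t - k"] by (simp add: Suc_diff_le)
  also have "[k..<t - k] = k # [Suc k..<t - k]"
    using assms by (simp add: upt_conv_Cons)
  finally show ?thesis by (simp add: inner_cols_def)
qed

lemma inner_cols_middle:
  "inner_cols t bs ((t + 1) div 2) =
    (if even t then residue_cols t (t div 2) (bs (t div 2)) else [])"
proof (cases "even t")
  case True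
  then obtain h where h: "t = 2 * h" by auto
  then have "[(t + 1) div 2..<t + 1 - (t + 1) div 2] = [h]" by simp
  then show ?thesis using h by (simp add: inner_cols_def)
next
  case False
  then obtain h where "t = 2 * h + 1" by (auto elim: oddE)
  then show ?thesis by (simp add: inner_cols_def)
qed

lemma length_inner_cols:
  assumes len: "\<And>i. 0 < i \<Longrightarrow> i < t \<Longrightarrow> length (bs i) + length (bs (t - i)) = 2 * n"
    and k: "k \<le> (t + 1) div 2" "0 < k"
  shows "length (inner_cols t bs k) = (t + 1 - 2 * k) * n"
  using k
proof (induction rule: inc_induct)
  case base
  show ?case
  proof (cases "even t")
    case True
    then obtain h where h: "t = 2 * h" by auto
    then have "inner_cols t bs ((t + 1) div 2) = residue_cols t h (bs h)"
      by (subst inner_cols_middle) simp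
    then show ?thesis using len[of h] base h by simp
  next
    case False
    then have "inner_cols t bs ((t + 1) div 2) = []" by (subst inner_cols_middle) simp
    moreover obtain h where "t = 2 * h + 1" using False by (auto elim: oddE)
    ultimately show ?thesis by simp
  qed
next
  case (step k)
  then have k: "2 * k < t" "0 < k" by auto
  have "length (inner_cols t bs k) = (length (bs k) + length (bs (t - k))) + (t + 1 - 2 * Suc k) * n"
    using step.IH k by (simp add: inner_cols_split)
  also have "\<dots> = (2 + (t + 1 - 2 * Suc k)) * n"
    using len[of k] k by (simp add: algebra_simps)
  also have "2 + (t + 1 - 2 * Suc k) = t + 1 - 2 * k" using k by simp
  finally show ?case .
qed

lemma mod_inner_cols:
  assumes "c \<in> set (inner_cols t bs k)" "0 < k"
  shows "k \<le> c mod t" "c mod t \<le> t - k"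
proof -
  obtain i where i: "k \<le> i" "i < t + 1 - k" "c \<in> set (residue_cols t i (bs i))"
    using assms by (auto simp: inner_cols_def)
  have "c mod t = i" using mod_residue_cols[OF i(3)] i assms by linarith
  then show "k \<le> c mod t" "c mod t \<le> t - k" using i by auto
qed

text \<open>Once rows and columns of \<open>k\<close> and \<open>t - k\<close> stand in front, the
  entries in these rows and the remaining columns vanish: no residue strictly between
  \<open>k\<close> and \<open>t - k\<close> is congruent to \<open>k\<close> or \<open>- k\<close>.
  The induction starts in the middle, which is empty for odd \<open>t\<close> and the single residue
  \<open>t div 2\<close> for even \<open>t\<close>.\<close>

lemma list_det_inner:
  fixes x :: "nat \<Rightarrow> 'a::field"
  assumes len: "\<And>i. 0 < i \<Longrightarrow> i < t \<Longrightarrow> length (bs i) + length (bs (t - i)) = 2 * n"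
    and x: "\<forall>i<n. x i \<noteq> 0"
    and k: "k \<le> (t + 1) div 2" "0 < k"
  shows "list_det (folded_entry t n x) [k * n..<(t + 1 - k) * n] (inner_cols t bs k)
    = (\<Prod>i = k..<(t + 1) div 2. (- 1) ^ pair_sign t n bs i * pair_factor t n x bs i)
      * middle_factor t n x bs"
  using k
proof (induction rule: inc_induct)
  case base
  show ?case
  proof (cases "even t")
    case True
    then obtain h where h: "t = 2 * h" by auto
    then have "[(t + 1) div 2 * n..<(t + 1 - (t + 1) div 2) * n] = row_block n h"
      by (simp add: row_block_def add.commute)
    moreover have "inner_cols t bs ((t + 1) div 2) = residue_cols t h (bs h)"
      using h by (subst inner_cols_middle) simp
    ultimately show ?thesis using h by (simp add: middle_factor_def)
  next
    case False
    then have "inner_cols t bs ((t + 1) div 2) = []" by (subst inner_cols_middle) simp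
    moreover obtain h where "t = 2 * h + 1" using False by (auto elim: oddE)
    ultimately show ?thesis by (simp add: middle_factor_def list_det_def)
  qed
next
  case (step k)
  then have k: "2 * k < t" "0 < k" by auto
  let ?G = "folded_entry t n x"
  let ?R = "row_block n" and ?C = "\<lambda>i. residue_cols t i (bs i)"
  let ?U = "[Suc k * n..<(t - k) * n]" and ?W = "inner_cols t bs (Suc k)"
  let ?L = "(t - 1 - 2 * k) * n"
  have lenW: "length ?W = ?L"
    using length_inner_cols[of t bs n "Suc k", OF len] step k by simp
  have e1: "t + 1 - Suc k = t - k" by simp
  have "length ?U = (t - k - Suc k) * n" by (simp only: length_upt diff_mult_distrib)
  then have lenU: "length ?U = ?L" using k by (simp add: mult_2)
  have lenC: "length (?C k) + length (?C (t - k)) = 2 * n" using len[of k] k by simp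
  have rows: "[k * n..<(t + 1 - k) * n] = ?R k @ ?U @ ?R (t - k)"
  proof -
    obtain d where d: "t - k = Suc k + d" using k by (intro that[of "t - k - Suc k"]) simp
    then have e: "t + 1 - k = Suc (Suc k + d)" using k by simp
    have app: "[a..<a + n + b + n] = [a..<a + n] @ [a + n..<a + n + b] @ [a + n + b..<a + n + b + n]" for a b
      using upt_add_eq_append[of a "a + n + b" n] upt_add_eq_append[of a "a + n" b] by simp
    have m: "Suc k * n = k * n + n" "(Suc k + d) * n = k * n + n + d * n"
      "Suc (Suc k + d) * n = k * n + n + (d * n + n)"
      by (simp_all add: algebra_simps)
    show ?thesis
      unfolding d e m row_block_def
      by (simp only: add.assoc[symmetric]) (rule app)
  qed
  have "list_det ?G [k * n..<(t + 1 - k) * n] (inner_cols t bs k)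
      = list_det ?G (?R k @ ?U @ ?R (t - k) @ []) (?C k @ ?W @ ?C (t - k) @ [])"
    unfolding rows inner_cols_split[OF k(1)] append_Nil2 ..
  also have "\<dots> = (- 1) ^ (?L * n) *
      list_det ?G (?R k @ ?R (t - k) @ ?U @ []) (?C k @ ?W @ ?C (t - k) @ [])"
  proof -
    have "length (?R k @ ?U @ ?R (t - k) @ []) = length (?C k @ ?W @ ?C (t - k) @ [])"
      unfolding length_append lenU lenW using lenC by simp
    from list_det_swap_row_blocks[OF this, of ?G] show ?thesis unfolding lenU length_row_block .
  qed
  also have "list_det ?G (?R k @ ?R (t - k) @ ?U @ []) (?C k @ ?W @ ?C (t - k) @ [])
      = (- 1) ^ (?L * length (bs (t - k))) *
        list_det ?G (?R k @ ?R (t - k) @ ?U @ []) (?C k @ ?C (t - k) @ ?W @ [])"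
  proof -
    have "length (?R k @ ?R (t - k) @ ?U @ []) = length (?C k @ ?W @ ?C (t - k) @ [])"
      unfolding length_append lenU lenW using lenC by simp
    from list_det_swap_blocks[OF this, of ?G] show ?thesis unfolding lenW length_residue_cols .
  qed
  also have "list_det ?G (?R k @ ?R (t - k) @ ?U @ []) (?C k @ ?C (t - k) @ ?W @ [])
      = list_det ?G ((?R k @ ?R (t - k)) @ ?U) ((?C k @ ?C (t - k)) @ ?W)"
    unfolding append_Nil2 append_assoc ..
  also have "\<dots> = list_det ?G (?R k @ ?R (t - k)) (?C k @ ?C (t - k)) * list_det ?G ?U ?W"
  proof (rule list_det_block_diagonal)
    fix r c assume r: "r \<in> set (?R k @ ?R (t - k))" and c: "c \<in> set ?W"
    have "r div n = k \<or> r div n = t - k" using r div_row_block by auto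
    moreover have "Suc k \<le> c mod t" "c mod t \<le> t - Suc k" using mod_inner_cols[OF c] by auto
    ultimately show "?G r c = 0"
    proof (elim disjE)
      assume "r div n = k" "Suc k \<le> c mod t" "c mod t \<le> t - Suc k"
      then show ?thesis using k by (intro folded_entry_eq_0) auto
    next
      assume a: "r div n = t - k" "Suc k \<le> c mod t" "c mod t \<le> t - Suc k"
      \<comment> \<open>The sum of column residue and row block exceeds \<open>t\<close> by
        \<open>Suc d\<close>, which lies strictly between 0 and \<open>t\<close>, so it is not
        divisible by \<open>t\<close>.\<close>
      define d where "d = c mod t - Suc k"
      then have d: "c mod t = k + Suc d" using a by simp
      then have "c mod t + (t - k) = Suc d + t" using k by simp
      moreover have "Suc d < t" using d a k by simp
      ultimately have "(c mod t + (t - k)) mod t \<noteq> 0"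
        by (simp only: mod_add_self2) simp
      then show ?thesis using a k by (intro folded_entry_eq_0) auto
    qed
  qed (unfold length_append lenU lenW, use lenC in simp_all)
  also have "list_det ?G (?R k @ ?R (t - k)) (?C k @ ?C (t - k))
      = (- 1) ^ (length (bs (t - k)) choose 2) * pair_factor t n x bs k"
    unfolding pair_factor_def using k lenC x by (intro list_det_pair_block) auto
  also have "list_det ?G ?U ?W = (\<Prod>i = Suc k..<(t + 1) div 2. (- 1) ^ pair_sign t n bs i * pair_factor t n x bs i)
      * middle_factor t n x bs"
    using step.IH k unfolding e1 by blast
  finally have eq: "list_det ?G [k * n..<(t + 1 - k) * n] (inner_cols t bs k) =
      (- 1) ^ (?L * n) * ((- 1) ^ (?L * length (bs (t - k))) *
      ((- 1) ^ (length (bs (t - k)) choose 2) * pair_factor t n x bs k *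
      ((\<Prod>i = Suc k..<(t + 1) div 2. (- 1) ^ pair_sign t n bs i * pair_factor t n x bs i)
      * middle_factor t n x bs)))" .
  have sgn: "(- 1 :: 'a) ^ pair_sign t n bs k
      = (- 1) ^ (?L * n) * (- 1) ^ (?L * length (bs (t - k))) * (- 1) ^ (length (bs (t - k)) choose 2)"
    by (simp add: pair_sign_def power_add distrib_right mult.commute)
  have prod: "(\<Prod>i = k..<(t + 1) div 2. (- 1) ^ pair_sign t n bs i * pair_factor t n x bs i)
      = (- 1) ^ pair_sign t n bs k * pair_factor t n x bs k *
        (\<Prod>i = Suc k..<(t + 1) div 2. (- 1) ^ pair_sign t n bs i * pair_factor t n x bs i)"
    by (rule prod.atLeast_Suc_lessThan) (use step.hyps in simp)
  show ?case by (simp only: eq prod sgn mult.assoc)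
qed

lemma list_det_folded_factorization:
  fixes x :: "nat \<Rightarrow> 'a::field"
  assumes t: "t > 0" and len0: "length (bs 0) = n"
    and len: "\<And>i. 0 < i \<Longrightarrow> i < t \<Longrightarrow> length (bs i) + length (bs (t - i)) = 2 * n"
    and x: "\<forall>i<n. x i \<noteq> 0"
  shows "list_det (folded_entry t n x) [0..<t * n] (concat (map (\<lambda>i. residue_cols t i (bs i)) [0..<t]))
    = list_det (\<lambda>i. sym_power (x i ^ t)) [0..<n] (bs 0) *
      ((\<Prod>i = 1..<(t + 1) div 2. (- 1) ^ pair_sign t n bs i * pair_factor t n x bs i)
      * middle_factor t n x bs)"
proof -
  have cols: "concat (map (\<lambda>i. residue_cols t i (bs i)) [0..<t]) = residue_cols t 0 (bs 0) @ inner_cols t bs 1"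
    using t by (simp add: inner_cols_def upt_conv_Cons)
  have rows: "[0..<t * n] = row_block n 0 @ [1 * n..<(t + 1 - 1) * n]"
    using t upt_add_eq_append[of 0 n "(t - 1) * n"] by (simp add: row_block_def algebra_simps)
  have lenI: "length (inner_cols t bs 1) = (t - 1) * n"
    using length_inner_cols[of t bs n 1, OF len] t by simp
  have "list_det (folded_entry t n x) (row_block n 0 @ [1 * n..<(t + 1 - 1) * n])
      (residue_cols t 0 (bs 0) @ inner_cols t bs 1)
    = list_det (folded_entry t n x) (row_block n 0) (residue_cols t 0 (bs 0)) *
      list_det (folded_entry t n x) [1 * n..<(t + 1 - 1) * n] (inner_cols t bs 1)"
  proof (rule list_det_block_diagonal)
    fix r c assume "r \<in> set (row_block n 0)" "c \<in> set (inner_cols t bs 1)"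
    then have "r div n = 0" "1 \<le> c mod t" "c mod t < t"
      using div_row_block mod_inner_cols[of c t bs 1] t by auto
    then show "folded_entry t n x r c = 0" by (intro folded_entry_eq_0) auto
  qed (use lenI len0 t in \<open>auto simp: diff_mult_distrib\<close>)
  also have "list_det (folded_entry t n x) (row_block n 0) (residue_cols t 0 (bs 0))
      = list_det (\<lambda>i. sym_power (x i ^ t)) [0..<n] (bs 0)"
    by (rule list_det_zero_block[OF t len0])
  also have "list_det (folded_entry t n x) [1 * n..<(t + 1 - 1) * n] (inner_cols t bs 1)
      = (\<Prod>i = 1..<(t + 1) div 2. (- 1) ^ pair_sign t n bs i * pair_factor t n x bs i)
        * middle_factor t n x bs"
    by (rule list_det_inner[of t bs n x 1, OF len x]) (use t in auto)
  finally show ?thesis unfolding cols rows .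
qed

section \<open>Quotients and characters\<close>

lemma length_filter_disj:
  assumes "\<And>a. a \<in> set xs \<Longrightarrow> \<not> (P a \<and> Q a)"
  shows "length (filter (\<lambda>a. P a \<or> Q a) xs) = length (filter P xs) + length (filter Q xs)"
  using assms by (induction xs) auto

lemma length_filter_row_block:
  assumes "k < t" "n > 0"
  shows "length (filter (\<lambda>r. r div n = k) [0..<t * n]) = n"
proof -
  have "{r. r < t * n \<and> r div n = k} = {k * n..<k * n + n}"
  proof (intro equalityI subsetI)
    fix r assume "r \<in> {r. r < t * n \<and> r div n = k}"
    then have "r = k * n + r mod n" "r mod n < n" using assms by (auto simp: mult.commute)
    then show "r \<in> {k * n..<k * n + n}" by (metis atLeastLessThan_iff le_add1 nat_add_left_cancel_less)
  next
    fix r assume r: "r \<in> {k * n..<k * n + n}"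
    then have "r div n = k" using div_row_block[of r n k] by (simp add: row_block_def)
    moreover have "k * n + n \<le> t * n" using mult_le_mono1[of "Suc k" t n] assms by simp
    ultimately show "r \<in> {r. r < t * n \<and> r div n = k}" using r by auto
  qed
  moreover have "length (filter (\<lambda>r. r div n = k) [0..<t * n]) = card {r. r < t * n \<and> r div n = k}"
    by (subst length_filter_conv_card) (auto intro!: arg_cong[of _ _ card])
  ultimately show ?thesis by simp
qed

lemma folded_entry_neq_0D:
  assumes "folded_entry t n x r c \<noteq> 0"
  shows "c mod t = r div n \<or> (c mod t + r div n) mod t = 0"
  using assms folded_entry_eq_0 by blast

text \<open>A nonzero entry needs row block and column residue to be equal or opposite modulo
  \<open>t\<close>, so the classes \<open>{0}\<close> and \<open>{i, t - i}\<close> of rows and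
  columns would have to match in size. The row classes have \<open>n\<close> and
  \<open>2 * n\<close> elements, the latter \<open>n\<close> if \<open>t - i = i\<close>.\<close>

lemma list_det_folded_eq_0:
  fixes x :: "nat \<Rightarrow> 'a::field" and w :: "nat list" and t n :: nat
  defines "cnt \<equiv> \<lambda>i. length (filter (\<lambda>c. c mod t = i) w)"
  assumes t: "t > 0" and n: "n > 0" and len: "length w = t * n"
    and ne: "cnt 0 \<noteq> n \<or> (\<exists>i. 0 < i \<and> i < t \<and> cnt i + cnt (t - i) \<noteq> 2 * n)"
  shows "list_det (folded_entry t n x) [0..<t * n] w = 0"
proof -
  have sum_mod: "(a + b) mod t = 0 \<longleftrightarrow> (a = 0 \<and> b = 0) \<or> a + b = t" if "a < t" "b < t" for a b
  proof (cases "a + b < t")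
    case False
    then have "(a + b) mod t = a + b - t" using that by (simp add: mod_if)
    then show ?thesis using False by auto
  qed auto
  have row_lt: "r div n < t" if "r \<in> set [0..<t * n]" for r
    using that by (simp add: less_mult_imp_div_less)
  have entry: "c mod t = r div n \<or> (c mod t = 0 \<and> r div n = 0) \<or> c mod t + r div n = t"
    if "r \<in> set [0..<t * n]" "folded_entry t n x r c \<noteq> 0" for r c
    using folded_entry_neq_0D[OF that(2)] sum_mod[OF _ row_lt[OF that(1)], of "c mod t"] t by auto
  have mod_lt: "c mod t < t" for c using t by simp
  from ne show ?thesis
  proof
    assume ne: "cnt 0 \<noteq> n"
    show ?thesis
    proof (rule list_det_class_mismatch[where P = "\<lambda>r. r div n = 0" and Q = "\<lambda>c. c mod t = 0"])
      show "length (filter (\<lambda>r. r div n = 0) [0..<t * n]) \<noteq> length (filter (\<lambda>c. c mod t = 0) w)"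
        unfolding length_filter_row_block[OF t n] using ne by (simp add: cnt_def)
      fix r c assume "r \<in> set [0..<t * n]" "folded_entry t n x r c \<noteq> 0"
      from entry[OF this] row_lt[OF this(1)] mod_lt[of c] show "(r div n = 0) = (c mod t = 0)" by linarith
    qed (use len in simp)
  next
    assume "\<exists>i. 0 < i \<and> i < t \<and> cnt i + cnt (t - i) \<noteq> 2 * n"
    then obtain i where i: "0 < i" "i < t" "cnt i + cnt (t - i) \<noteq> 2 * n" by blast
    show ?thesis
    proof (rule list_det_class_mismatch[where P = "\<lambda>r. r div n = i \<or> r div n = t - i"
          and Q = "\<lambda>c. c mod t = i \<or> c mod t = t - i"])
      show "length (filter (\<lambda>r. r div n = i \<or> r div n = t - i) [0..<t * n]) \<noteq>
        length (filter (\<lambda>c. c mod t = i \<or> c mod t = t - i) w)"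
      proof (cases "t - i = i")
        \<comment> \<open>The class is a single residue here, and the assumption counts it
          twice.\<close>
        case True
        then show ?thesis using length_filter_row_block[OF i(2) n] i by (simp add: cnt_def)
      next
        case False
        have "t - i < t" using i by simp
        from length_filter_row_block[OF i(2) n] length_filter_row_block[OF this n] show ?thesis
          using i False by (subst (1 2) length_filter_disj) (auto simp: cnt_def)
      qed
      fix r c assume "r \<in> set [0..<t * n]" "folded_entry t n x r c \<noteq> 0"
      from entry[OF this] row_lt[OF this(1)] mod_lt[of c] i(1,2)
      show "(r div n = i \<or> r div n = t - i) = (c mod t = i \<or> c mod t = t - i)" by linarith
    qed (use len in simp)
  qed
qed

section \<open>Beta sets of the quotients and the sorting permutation\<close>

lemma nth_ge_of_strict_decreasing:
  fixes xs :: "nat list"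
  assumes "sorted_wrt (>) xs" "j < length xs"
  shows "length xs - Suc j \<le> xs ! j"
  using assms
proof (induction xs arbitrary: j)
  case (Cons a xs)
  show ?case
  proof (cases j)
    case 0
    show ?thesis
    proof (cases xs)
      case (Cons b ys)
      then have "length xs - Suc 0 \<le> xs ! 0" using Cons.IH[of 0] Cons.prems by simp
      moreover have "xs ! 0 < a" using Cons.prems Cons by simp
      ultimately show ?thesis using 0 Cons by simp
    qed (use 0 in simp)
  qed (use Cons in simp)
qed simp

lemma beta_strict_decreasing:
  assumes "antimono l" "i < j" "j < m"
  shows "beta l m j < beta l m i"
  using antimonoD[OF assms(1), of i j] assms by (simp add: beta_def)

lemma inj_on_beta:
  assumes "antimono l"
  shows "inj_on (beta l m) {..<m}"
  using beta_strict_decreasing[OF assms] by (intro linorder_inj_onI) force+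

lemma card_beta_residue:
  assumes "antimono l"
  shows "card {b \<in> beta l m ` {..<m}. b mod t = i} = beta_count t l m i"
proof -
  have "{b \<in> beta l m ` {..<m}. b mod t = i} = beta l m ` {j. j < m \<and> beta l m j mod t = i}" by auto
  moreover have "inj_on (beta l m) {j. j < m \<and> beta l m j mod t = i}"
    using inj_on_beta[OF assms] by (rule inj_on_subset) auto
  ultimately show ?thesis by (simp add: card_image beta_count_def)
qed

lemma set_beta_residue: "set (beta_residue t l m i) = {b \<in> beta l m ` {..<m}. b mod t = i}"
  by (simp add: beta_residue_def)

lemma length_beta_residue:
  assumes "antimono l"
  shows "length (beta_residue t l m i) = beta_count t l m i"
  using card_beta_residue[OF assms] by (simp add: beta_residue_def)

text \<open>The reduced beta set of quotient \<open>i\<close>, rebuilt from the parts so that it has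
  the shape of the exponents in a character. That it also lists the entries of residue
  \<open>i\<close> divided by \<open>t\<close> is \<open>quotient_beta_eq_div\<close>.\<close>

definition quotient_beta :: "nat \<Rightarrow> (nat \<Rightarrow> nat) \<Rightarrow> nat \<Rightarrow> nat \<Rightarrow> nat list" where
  "quotient_beta t l m i =
     map (\<lambda>j. t_quotient t l m i j + (beta_count t l m i - Suc j)) [0..<beta_count t l m i]"

lemma length_quotient_beta [simp]: "length (quotient_beta t l m i) = beta_count t l m i"
  by (simp add: quotient_beta_def)

lemma quotient_beta_eq_div:
  assumes "antimono l"
  shows "quotient_beta t l m i = map (\<lambda>b. b div t) (beta_residue t l m i)"
proof -
  let ?L = "beta_residue t l m i"
  have len: "length ?L = beta_count t l m i" by (rule length_beta_residue[OF assms])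
  have "sorted_wrt (>) ?L"
    unfolding beta_residue_def by (simp add: sorted_wrt_rev strict_sorted_list_of_set)
  then have "sorted_wrt (\<lambda>a b. b div t < a div t) ?L"
  proof (rule sorted_wrt_mono_rel[rotated])
    fix a b assume "a \<in> set ?L" "b \<in> set ?L" "b < a"
    then have mod: "a mod t = b mod t" by (simp add: set_beta_residue)
    have "b div t \<le> a div t" using \<open>b < a\<close> by (simp add: div_le_mono)
    moreover have "b div t \<noteq> a div t" using mod \<open>b < a\<close> by (metis less_irrefl mult_div_mod_eq)
    ultimately show "b div t < a div t" by simp
  qed
  then have sorted: "sorted_wrt (>) (map (\<lambda>b. b div t) ?L)" by (simp add: sorted_wrt_map)
  show ?thesis
  proof (rule nth_equalityI)
    fix j assume "j < length (quotient_beta t l m i)"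
    then have j: "j < beta_count t l m i" by simp
    \<comment> \<open>In a strictly decreasing list of natural numbers every entry is at least the
      number of later ones, so the subtraction in \<open>t_quotient\<close> is exact.\<close>
    then have "beta_count t l m i - Suc j \<le> ?L ! j div t"
      using nth_ge_of_strict_decreasing[OF sorted, of j] len by simp
    then show "quotient_beta t l m i ! j = map (\<lambda>b. b div t) ?L ! j"
      using j len by (simp add: quotient_beta_def t_quotient_def)
  qed (simp add: len)
qed

lemma beta_residue_eq_residue_cols:
  assumes "antimono l"
  shows "beta_residue t l m i = residue_cols t i (quotient_beta t l m i)"
proof -
  have "t * (b div t) + i = b" if "b \<in> set (beta_residue t l m i)" for b
    using that mult_div_mod_eq[of t b] by (simp add: set_beta_residue)
  then show ?thesis
    unfolding residue_cols_def quotient_beta_eq_div[OF assms]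
    by (simp add: comp_def map_idI)
qed

text \<open>The beta numbers are distinct, so exactly one permutation produces the sorted list; this
  gives meaning to the definite description.\<close>

lemma sorting_perm_properties:
  assumes anti: "antimono l" and t: "t > 0"
  shows "sorting_perm t l m permutes {..<m}"
    and "map (\<lambda>k. beta l m (sorting_perm t l m k)) [0..<m] = concat (map (beta_residue t l m) [0..<t])"
proof -
  let ?W = "concat (map (beta_residue t l m) [0..<t])"
  let ?B = "map (beta l m) [0..<m]"
  have inj: "inj_on (beta l m) {..<m}" by (rule inj_on_beta[OF anti])
  have "distinct (concat (map (beta_residue t l m) xs))" if "distinct xs" for xs
    using that
  proof (induction xs)
    case (Cons i xs)
    then show ?case by (auto simp: set_beta_residue) (auto simp: beta_residue_def)
  qed simp
  then have "distinct ?W" by simp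
  moreover have "set ?W = set ?B" using t by (auto simp: set_beta_residue)
  moreover have "distinct ?B" using inj by (simp add: distinct_map atLeast0LessThan)
  ultimately have "mset ?W = mset ?B" using set_eq_iff_mset_eq_distinct by blast
  then obtain p where p: "p permutes {..<length ?B}" "permute_list p ?B = ?W"
    using mset_eq_permutation by metis
  have pm: "p permutes {..<m}" using p by simp
  have lt: "q permutes {..<m} \<Longrightarrow> k < m \<Longrightarrow> q k < m" for q k
    using permutes_in_image[of q "{..<m}" k] by simp
  have mp: "map (\<lambda>k. beta l m (p k)) [0..<m] = ?W"
    unfolding p(2)[symmetric] permute_list_def using lt[OF pm] by auto
  have uniq: "q = p" if q: "q permutes {..<m}" "map (\<lambda>k. beta l m (q k)) [0..<m] = ?W" for q
  proof
    fix k
    show "q k = p k"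
    proof (cases "k < m")
      case True
      have "beta l m (q k) = beta l m (p k)"
        using arg_cong[OF trans[OF q(2) mp[symmetric]], of "\<lambda>xs. xs ! k"] True
        by simp
      then show ?thesis using inj_onD[OF inj] lt[OF q(1) True] lt[OF pm True] by simp
    next
      case False
      then show ?thesis using q(1) pm by (simp add: permutes_not_in)
    qed
  qed
  have "sorting_perm t l m = p"
    unfolding sorting_perm_def
    by (rule the_equality, rule conjI[OF pm mp], elim conjE, rule uniq)
  then show "sorting_perm t l m permutes {..<m}"
    and "map (\<lambda>k. beta l m (sorting_perm t l m k)) [0..<m] = ?W"
    using pm mp by simp_all
qed

lemma list_det_beta:
  assumes anti: "antimono l" and t: "t > 0" and len: "length u = m"
  shows "list_det g u (map (beta l m) [0..<m]) = of_int (sign (sorting_perm t l m)) *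
    list_det g u (concat (map (\<lambda>i. residue_cols t i (quotient_beta t l m i)) [0..<t]))"
proof -
  let ?B = "map (beta l m) [0..<m]" and ?p = "sorting_perm t l m"
  note p = sorting_perm_properties[OF anti t, of m]
  have lt: "k < m \<Longrightarrow> ?p k < m" for k using permutes_in_image[OF p(1), of k] by simp
  have "map (\<lambda>k. ?B ! ?p k) [0..<length ?B] = map (\<lambda>k. beta l m (?p k)) [0..<m]"
    using lt by auto
  then have "list_det g u (concat (map (\<lambda>i. residue_cols t i (quotient_beta t l m i)) [0..<t]))
      = of_int (sign ?p) * list_det g u ?B"
    using list_det_permute_cols[of u ?B ?p g] len p
    by (simp add: beta_residue_eq_residue_cols[OF anti, symmetric])
  \<comment> \<open>The sign is its own inverse and can be moved to the other side.\<close>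
  moreover have "of_int (sign ?p) * of_int (sign ?p) = (1 :: 'b)"
    by (simp add: sign_def)
  ultimately show ?thesis by (simp add: mult.assoc[symmetric])
qed

section \<open>Characters as quotients of list determinants\<close>

lemma oeven_denom_eq: "oeven_denom N y = list_det (\<lambda>i. sym_power (y i)) [0..<N] (rev [0..<N])"
  unfolding oeven_denom_def list_det_def sym_power_def
  by (intro arg_cong[of _ _ det] eq_matI) (auto simp: rev_nth of_nat_diff simp del: power_int_of_nat)

lemma oeven_char_eq:
  "oeven_char N (\<lambda>j. int (m j)) y = list_det (\<lambda>i. sym_power (y i)) [0..<N] (map (beta m N) [0..<N]) /
     ((if m (N - 1) = 0 then 2 else 1) * oeven_denom N y)"
proof -
  have "mat N N (\<lambda>(i, j). y i powi (int (m j) + int N - int (Suc j))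
      + y i powi (- (int (m j) + int N - int (Suc j)))) =
    mat N N (\<lambda>(i, j). sym_power (y ([0..<N] ! i)) (map (beta m N) [0..<N] ! j))"
    by (intro eq_matI) (auto simp: sym_power_def beta_def of_nat_diff algebra_simps simp del: power_int_of_nat)
  then show ?thesis by (simp add: oeven_char_def list_det_def)
qed

lemma so_char_eq:
  "so_char N (\<lambda>j. int (m j)) y =
     list_det (\<lambda>i b. y i powi (int b + 1) - y i powi (- int b)) [0..<N] (map (beta m N) [0..<N]) /
     list_det (\<lambda>i b. y i powi (int b + 1) - y i powi (- int b)) [0..<N] (rev [0..<N])"
proof -
  have "mat N N (\<lambda>(i, j). y i powi (int (m j) + int N - int (Suc j) + 1)
      - y i powi (- (int (m j) + int N - int (Suc j)))) =
    mat N N (\<lambda>(i, j). y ([0..<N] ! i) powi (int (map (beta m N) [0..<N] ! j) + 1)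
      - y ([0..<N] ! i) powi (- int (map (beta m N) [0..<N] ! j)))"
    by (intro eq_matI) (auto simp: beta_def of_nat_diff algebra_simps)
  moreover have "mat N N (\<lambda>(i, j). y i powi (int N - int (Suc j) + 1) - y i powi (- (int N - int (Suc j)))) =
    mat N N (\<lambda>(i, j). y ([0..<N] ! i) powi (int (rev [0..<N] ! j) + 1)
      - y ([0..<N] ! i) powi (- int (rev [0..<N] ! j)))"
    by (intro eq_matI) (auto simp: rev_nth of_nat_diff algebra_simps)
  ultimately show ?thesis by (simp add: so_char_def list_det_def)
qed

text \<open>The \<open>2 * n\<close> variables multiply to 1, so scaling each row by the
  \<open>s\<close>-th power of its variable has no effect on the determinant.\<close>

lemma list_det_power_inverse_shift:
  fixes x :: "nat \<Rightarrow> 'a::field"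
  assumes x: "\<forall>i<n. x i \<noteq> 0" and len: "length es = 2 * n"
  shows "list_det (\<lambda>i e. power_inverse_vars t n x i powi e) [0..<2 * n] (map (\<lambda>e. e + s) es)
    = list_det (\<lambda>i e. power_inverse_vars t n x i powi e) [0..<2 * n] es"
proof -
  let ?z = "power_inverse_vars t n x"
  have z: "?z i \<noteq> 0" if "i < 2 * n" for i
    using x that by (auto simp: power_inverse_vars_def)
  have "list_det (\<lambda>i e. ?z i powi e) [0..<2 * n] (map (\<lambda>e. e + s) es)
      = list_det (\<lambda>i e. ?z i powi s * ?z i powi e) [0..<2 * n] es"
    using len list_det_map[of "[0..<2 * n]" es "\<lambda>i e. ?z i powi e" id "\<lambda>e. e + s"]
    by (simp, intro list_det_cong) (auto simp: power_int_add z)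
  also have "\<dots> = prod_list (map (\<lambda>i. ?z i powi s) [0..<2 * n]) * list_det (\<lambda>i e. ?z i powi e) [0..<2 * n] es"
    using len by (intro list_det_scale_rows) simp
  also have "prod_list (map (\<lambda>i. ?z i powi s) [0..<2 * n]) = 1"
  proof -
    have "[0..<2 * n] = [0..<n] @ map (\<lambda>i. i + n) [0..<n]"
      by (simp add: map_add_upt mult_2 flip: upt_add_eq_append)
    then have "prod_list (map (\<lambda>i. ?z i powi s) [0..<2 * n])
        = prod_list (map (\<lambda>i. (x i powi int t) powi s) [0..<n]) *
          prod_list (map (\<lambda>i. (x i powi (- int t)) powi s) [0..<n])"
      by (simp only: map_append prod_list.append map_map comp_def)
        (intro arg_cong2[of _ _ _ _ "(*)"] arg_cong[of _ _ prod_list] map_cong; simp add: power_inverse_vars_def)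
    also have "\<dots> = 1"
      using x by (auto simp: prod.distinct_set_conv_list[symmetric] power_int_minus
          power_int_inverse simp flip: prod.distrib)
    finally show ?thesis .
  qed
  finally show ?thesis by simp
qed

lemma schur_char_mu2:
  fixes x :: "nat \<Rightarrow> 'a::field"
  assumes x: "\<forall>i<n. x i \<noteq> 0"
    and cnt: "beta_count t l (t * n) i + beta_count t l (t * n) (t - i) = 2 * n"
  shows "schur_char (2 * n) (mu2 t n l i) (power_inverse_vars t n x) =
    pair_factor t n x (quotient_beta t l (t * n)) i / pair_factor t n x (\<lambda>_. rev [0..<n]) i"
proof -
  let ?z = "power_inverse_vars t n x"
  let ?n = "beta_count t l (t * n)" and ?q = "t_quotient t l (t * n)"
  let ?Q = "quotient_beta t l (t * n)"
  let ?es = "map int (?Q i) @ map (\<lambda>b. - int b - 1) (rev (?Q (t - i)))"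
  let ?e0 = "map int (rev [0..<n]) @ map (\<lambda>b. - int b - 1) (rev (rev [0..<n]))"
  \<comment> \<open>The difference between the exponent \<open>mu2 t n l i j + 2 * n - Suc j\<close>
    and the \<open>j\<close>-th entry of \<open>?es\<close>. It is the same in both groups of
    columns because the two bead counts add up to \<open>2 * n\<close>. For the denominator the
    corresponding shift is \<open>n\<close>.\<close>
  let ?s = "int (?q (t - i) 0) + 2 * int n - int (?n i)"
  have num: "det (mat (2 * n) (2 * n) (\<lambda>(i', j). ?z i' powi (mu2 t n l i j + int (2 * n) - int (Suc j))))
      = list_det (\<lambda>i e. ?z i powi e) [0..<2 * n] (map (\<lambda>e. e + ?s) ?es)"
  proof -
    have "mu2 t n l i j + int (2 * n) - int (Suc j) = map (\<lambda>e. e + ?s) ?es ! j" if j: "j < 2 * n" for j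
    proof (cases "j < ?n i")
      case True
      then show ?thesis using j cnt
        by (simp add: mu2_def nth_append quotient_beta_def of_nat_diff)
    next
      case False
      have "j - ?n i < ?n (t - i)" using False j cnt by simp
      moreover have "?n (t - i) - Suc (j - ?n i) = 2 * n - Suc j" using False j cnt by simp
      moreover have "?n (t - i) - Suc (2 * n - Suc j) = j - ?n i" using False j cnt by simp
      moreover have "2 * n - Suc j < ?n (t - i)" using False j cnt by simp
      ultimately show ?thesis using False j cnt
        by (simp add: mu2_def nth_append quotient_beta_def rev_nth of_nat_diff)
    qed
    then show ?thesis
      unfolding list_det_def by (intro arg_cong[of _ _ det] eq_matI) auto
  qed
  have den: "det (mat (2 * n) (2 * n) (\<lambda>(i', j). ?z i' powi (int (2 * n) - int (Suc j))))
      = list_det (\<lambda>i e. ?z i powi e) [0..<2 * n] (map (\<lambda>e. e + int n) ?e0)"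
  proof -
    have "int (2 * n) - int (Suc j) = map (\<lambda>e. e + int n) ?e0 ! j" if "j < 2 * n" for j
      using that by (cases "j < n") (auto simp: nth_append rev_nth of_nat_diff)
    then show ?thesis
      unfolding list_det_def by (intro arg_cong[of _ _ det] eq_matI) auto
  qed
  have "length ?es = 2 * n" "length ?e0 = 2 * n" using cnt by auto
  then show ?thesis
    unfolding schur_char_def num den pair_factor_def by (simp only: list_det_power_inverse_shift[OF x])
qed

section \<open>Signs\<close>

lemma even_sum_cong:
  fixes f g :: "'b \<Rightarrow> nat"
  assumes "\<And>i. i \<in> A \<Longrightarrow> even (f i) \<longleftrightarrow> even (g i)"
  shows "even (sum f A) \<longleftrightarrow> even (sum g A)"
  using assms by (induction A rule: infinite_finite_induct) auto

lemma sum_reflect_upper_half: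
  fixes f :: "nat \<Rightarrow> 'b::comm_monoid_add"
  shows "(\<Sum>i = (t + 2) div 2..t - 1. f i) = (\<Sum>i = 1..<(t + 1) div 2. f (t - i))"
  by (rule sum.reindex_bij_witness[of _ "\<lambda>i. t - i" "\<lambda>i. t - i"]) auto

lemma Suc_choose_two: "Suc n choose 2 = (n choose 2) + n"
  by (simp add: numeral_2_eq_2)

lemma even_double_choose_two: "even ((2 * h) choose 2) \<longleftrightarrow> even h"
proof -
  have eq: "(2 * h) choose 2 = h * (2 * h - 1)" by (simp add: choose_two)
  show ?thesis unfolding eq by (cases h) auto
qed

lemma exponent_even_case: "n * (n + 2 * h - 1) div 2 = (n choose 2) + h * n"
proof (cases n)
  case (Suc k)
  have "n * (n + 2 * h - 1) = n * (n - 1) + 2 * (h * n)"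
    by (simp add: Suc algebra_simps)
  then show ?thesis by (simp add: choose_two)
qed simp

text \<open>The right-hand side collects the sign of sorting the empty beta set and, for each pair,
  the signs of the partition (with \<open>nn (t - i)\<close>) and of the empty partition (with
  \<open>n\<close>). The block moves contribute multiples of \<open>t - 1 - 2 * i\<close>, which is
  odd for even \<open>t\<close> and even for odd \<open>t\<close>; only the first case leaves a term
  for the rank.\<close>

lemma sign_exponent_parity:
  fixes nn :: "nat \<Rightarrow> nat"
  assumes t: "t \<ge> 2"
    and r: "even t \<Longrightarrow> even r \<longleftrightarrow> even (\<Sum>i = 1..<(t + 1) div 2. nn (t - i) + n)"
  shows "even (- (\<Sum>i = (t + 2) div 2..t - 1. int (nn i choose 2))
      + (if even t then int (n * (n + t - 1) div 2 + n * r) else int ((t - 1) * n div 2)))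
    \<longleftrightarrow> even ((t choose 2) * (Suc n choose 2) +
        (\<Sum>i = 1..<(t + 1) div 2. ((n + nn (t - i)) * ((t - 1 - 2 * i) * n) + (nn (t - i) choose 2))
          + ((n + n) * ((t - 1 - 2 * i) * n) + (n choose 2))))"
    (is "even ?e \<longleftrightarrow> even (?c + sum ?f ?A)")
proof -
  let ?S = "\<Sum>i\<in>?A. nn (t - i) choose 2"
  have S: "(\<Sum>i = (t + 2) div 2..t - 1. int (nn i choose 2)) = int ?S"
    by (subst sum_reflect_upper_half) simp
  show ?thesis
  proof (cases "even t")
    case True
    then obtain h where h: "t = 2 * h" by auto
    have h0: "h > 0" using t h by simp
    have "even (sum ?f ?A) \<longleftrightarrow> even (\<Sum>i\<in>?A. n * (nn (t - i) + n) + (nn (t - i) choose 2) + (n choose 2))"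
    proof (rule even_sum_cong)
      fix i assume "i \<in> ?A"
      then have "t - 1 - 2 * i = 2 * (h - 1 - i) + 1" using h by auto
      then have "odd (t - 1 - 2 * i)" by simp
      then show "even (?f i) \<longleftrightarrow> even (n * (nn (t - i) + n) + (nn (t - i) choose 2) + (n choose 2))" by auto
    qed
    also have "(\<Sum>i\<in>?A. n * (nn (t - i) + n) + (nn (t - i) choose 2) + (n choose 2))
        = n * (\<Sum>i\<in>?A. nn (t - i) + n) + ?S + (h - 1) * (n choose 2)"
      using h by (simp add: sum.distrib sum_distrib_left distrib_left mult_ac)
    finally have f: "even (sum ?f ?A) \<longleftrightarrow> even (n * r + ?S + (h - 1) * (n choose 2))"
      using r[OF True] by simp
    have e: "even ?e \<longleftrightarrow> even (((n choose 2) + h * n + n * r) + ?S)"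
      unfolding S using True exponent_even_case[of n h] by (simp add: h del: of_nat_sum)
    have c: "even ?c \<longleftrightarrow> even (h * ((n choose 2) + n))"
      unfolding h by (simp add: even_double_choose_two Suc_choose_two)
    \<comment> \<open>The multiples \<open>h\<close> and \<open>h - 1\<close> of
      \<open>n choose 2\<close> leave a single copy of it modulo 2.\<close>
    show ?thesis unfolding e even_add[of ?c] f c using h0 by (auto simp: even_diff_nat)
  next
    case False
    then obtain h where h: "t = 2 * h + 1" by (auto elim: oddE)
    have "even (sum ?f ?A) \<longleftrightarrow> even (\<Sum>i\<in>?A. (nn (t - i) choose 2) + (n choose 2))"
    proof (rule even_sum_cong)
      fix i assume "i \<in> ?A"
      then have "t - 1 - 2 * i = 2 * (h - i)" using h by auto
      then have "even (t - 1 - 2 * i)" by simp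
      then show "even (?f i) \<longleftrightarrow> even ((nn (t - i) choose 2) + (n choose 2))" by auto
    qed
    also have "(\<Sum>i\<in>?A. (nn (t - i) choose 2) + (n choose 2)) = ?S + h * (n choose 2)"
      using h by (simp add: sum.distrib)
    finally have f: "even (sum ?f ?A) \<longleftrightarrow> even (?S + h * (n choose 2))" .
    have e: "even ?e \<longleftrightarrow> even (h * n + ?S)"
      unfolding S using False by (simp add: h del: of_nat_sum)
    have c: "even ?c \<longleftrightarrow> even (h * ((n choose 2) + n))"
      unfolding h by (simp add: even_double_choose_two Suc_choose_two)
    show ?thesis unfolding e even_add[of ?c] f c by auto
  qed
qed

text \<open>The excesses \<open>n_i - n\<close> and \<open>n_(t-i) - n\<close> are opposite, so
  their positive parts add up to \<open>|n_i - n|\<close>, which has the parity of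
  \<open>n_(t-i) + n\<close>. Runners 0 and \<open>t div 2\<close> have excess 0.\<close>

lemma rank_parity:
  fixes nn :: "nat \<Rightarrow> nat"
  assumes t: "t \<ge> 2" "even t" and nn0: "nn 0 = n"
    and nn: "\<And>i. 0 < i \<Longrightarrow> i < t \<Longrightarrow> nn i + nn (t - i) = 2 * n"
  shows "even (\<Sum>i<t. nat (int (nn i) - int n)) \<longleftrightarrow> even (\<Sum>i = 1..<(t + 1) div 2. nn (t - i) + n)"
proof -
  let ?d = "\<lambda>i. nat (int (nn i) - int n)"
  obtain h where h: "t = 2 * h" using t by auto
  have h0: "h > 0" using t h by simp
  have dh: "?d h = 0" using nn[of h] h h0 by simp
  have "(\<Sum>i<t. ?d i) = (\<Sum>i = 0..<1. ?d i) + (\<Sum>i = 1..<h. ?d i) + (\<Sum>i = h..<h + 1. ?d i) + (\<Sum>i = h + 1..<2 * h. ?d i)"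
  proof -
    have "(\<Sum>i = 0..<1. ?d i) + (\<Sum>i = 1..<2 * h. ?d i) = (\<Sum>i = 0..<2 * h. ?d i)"
      "(\<Sum>i = 1..<h. ?d i) + (\<Sum>i = h..<2 * h. ?d i) = (\<Sum>i = 1..<2 * h. ?d i)"
      "(\<Sum>i = h..<h + 1. ?d i) + (\<Sum>i = h + 1..<2 * h. ?d i) = (\<Sum>i = h..<2 * h. ?d i)"
      by (rule sum.atLeastLessThan_concat; use h0 in simp)+
    then show ?thesis unfolding h atLeast0LessThan[symmetric] by linarith
  qed
  also have "\<dots> = (\<Sum>i = 1..<h. ?d i) + (\<Sum>i = h + 1..<2 * h. ?d i)" using dh nn0 by simp
  also have "(\<Sum>i = h + 1..<2 * h. ?d i) = (\<Sum>i = 1..<h. ?d (t - i))"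
    by (rule sum.reindex_bij_witness[of _ "\<lambda>i. t - i" "\<lambda>i. t - i"]) (auto simp: h)
  finally have "(\<Sum>i<t. ?d i) = (\<Sum>i = 1..<h. ?d i + ?d (t - i))" by (simp add: sum.distrib)
  moreover have "even (\<Sum>i = 1..<h. ?d i + ?d (t - i)) \<longleftrightarrow> even (\<Sum>i = 1..<h. nn (t - i) + n)"
  proof (rule even_sum_cong)
    fix i assume "i \<in> {1..<h}"
    then have "nn i + nn (t - i) = 2 * n" using nn[of i] h by auto
    then have "?d i + ?d (t - i) = (if n \<le> nn i then nn i - n else n - nn i)"
      "nn (t - i) + n = 3 * n - nn i" "nn i \<le> 2 * n" by auto
    then show "even (?d i + ?d (t - i)) \<longleftrightarrow> even (nn (t - i) + n)" by (auto simp: even_diff_nat)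
  qed
  ultimately show ?thesis using h by simp
qed

lemma minus_one_powi_eq:
  assumes "even e \<longleftrightarrow> even (k :: nat)"
  shows "(- 1 :: 'a::field) powi e = (- 1) ^ k"
  using assms by (simp add: power_int_minus_left minus_one_power_iff)

text \<open>The row factors cancel against those of the empty partition, as do the signs from
  \<open>n\<close> and from the staircase \<open>n - 1, ..., 0\<close>; only the parts of the
  quotient remain in the exponent of -1.\<close>

lemma middle_factor_ratio:
  fixes x :: "nat \<Rightarrow> 'a::field"
  assumes t: "t = 2 * h" "h > 0" and x: "\<forall>i<n. x i \<noteq> 0"
    and cnt: "beta_count t l m h = n"
  shows "middle_factor t n x (quotient_beta t l m) / middle_factor t n x (\<lambda>_. rev [0..<n])
    = (- 1) ^ (\<Sum>j<n. t_quotient t l m h j) * so_char n (\<lambda>j. int (t_quotient t l m h j)) (\<lambda>i. - (x i ^ t))"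
proof -
  let ?H = "\<lambda>i b. (- (x i ^ t)) powi (int b + 1) - (- (x i ^ t)) powi (- int b)"
  let ?Q = "quotient_beta t l m h" and ?c = "prod_list (map (\<lambda>i. x i powi (- int h)) [0..<n])"
  let ?q = "t_quotient t l m h"
  have lenQ: "length ?Q = n" using cnt by simp
  have Q: "?Q = map (beta ?q n) [0..<n]" by (simp add: quotient_beta_def cnt beta_def)
  have c: "?c \<noteq> 0" using x by auto
  have "sum_list ?Q = (\<Sum>j<n. ?q j + (n - Suc j))"
    unfolding quotient_beta_def cnt by (simp add: interv_sum_list_conv_sum_set_nat atLeast0LessThan)
  also have "\<dots> = (\<Sum>j<n. ?q j) + (\<Sum>j<n. n - Suc j)" by (rule sum.distrib)
  also have "(\<Sum>j<n. n - Suc j) = sum_list (rev [0..<n])"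
    using sum.nat_diff_reindex[of "\<lambda>j. j" n]
    by (simp add: interv_sum_list_conv_sum_set_nat[of "\<lambda>j. j", simplified] atLeast0LessThan)
  finally have s: "sum_list ?Q = (\<Sum>j<n. ?q j) + sum_list (rev [0..<n])" .
  have "middle_factor t n x (quotient_beta t l m)
      = ?c * (- 1) ^ (sum_list ?Q + n) * list_det ?H [0..<n] ?Q"
    using list_det_half_block[OF t lenQ x] t by (simp add: middle_factor_def)
  moreover have "middle_factor t n x (\<lambda>_. rev [0..<n])
      = ?c * (- 1) ^ (sum_list (rev [0..<n]) + n) * list_det ?H [0..<n] (rev [0..<n])"
    using list_det_half_block[OF t _ x, of "rev [0..<n]"] t by (simp add: middle_factor_def)
  ultimately show ?thesis
    unfolding so_char_eq Q[symmetric] s using c by (simp add: power_add)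
qed

text \<open>A last part is 0 exactly if the beta set contains 0, and the number 0 has residue 0 and
  quotient 0. The equivalence matches the factors \<open>1 + \<delta>\<close> in the two even
  orthogonal characters.\<close>

lemma last_part_eq_0_iff:
  assumes anti: "antimono l" and t: "t > 0" and n: "n > 0" and cnt: "beta_count t l (t * n) 0 = n"
  shows "l (t * n - 1) = 0 \<longleftrightarrow> t_quotient t l (t * n) 0 (n - 1) = 0"
proof -
  let ?N = "t * n" and ?q = "t_quotient t l (t * n) 0"
  have N: "?N > 0" using t n by simp
  have "l (?N - 1) = 0 \<longleftrightarrow> 0 \<in> set (beta_residue t l ?N 0)"
  proof
    assume "l (?N - 1) = 0"
    then have "beta l ?N (?N - 1) = 0" using N by (simp add: beta_def)
    then show "0 \<in> set (beta_residue t l ?N 0)"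
      using N unfolding set_beta_residue by (auto simp: image_iff intro!: bexI[of _ "?N - 1"])
  next
    assume "0 \<in> set (beta_residue t l ?N 0)"
    then obtain j where j: "j < ?N" "beta l ?N j = 0" by (auto simp: set_beta_residue)
    then have "j = ?N - 1" "l j = 0" by (auto simp: beta_def)
    then show "l (?N - 1) = 0" by simp
  qed
  also have "\<dots> \<longleftrightarrow> 0 \<in> set (quotient_beta t l ?N 0)"
    unfolding beta_residue_eq_residue_cols[OF anti] residue_cols_def using t by auto
  also have "\<dots> \<longleftrightarrow> ?q (n - 1) = 0"
  proof
    assume "0 \<in> set (quotient_beta t l ?N 0)"
    then obtain j where j: "j < n" "?q j + (n - Suc j) = 0" by (auto simp: quotient_beta_def cnt)
    then have "j = n - 1" by simp
    then show "?q (n - 1) = 0" using j by simp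
  next
    assume "?q (n - 1) = 0"
    then show "0 \<in> set (quotient_beta t l ?N 0)"
      using n by (auto simp: quotient_beta_def cnt image_iff intro!: bexI[of _ "n - 1"])
  qed
  finally show ?thesis .
qed

section \<open>Assembly of the vanishing and the factorization\<close>

theorem theorem2p15:
  fixes t n :: nat and \<omega> :: "'a::field_char_0" and x :: "nat \<Rightarrow> 'a" and l :: "nat \<Rightarrow> nat"
  assumes "t \<ge> 2" and "n \<ge> 1"
    and "primitive_root_of_unity t \<omega>"
    and "\<forall>i<n. x i \<noteq> 0"
    and "oeven_denom (t * n) (twisted_vars n \<omega> x) \<noteq> 0"
    and "is_partition l" and "num_parts l \<le> t * n"
  shows
    "(\<not> orthogonal_t_core t (t_core t l) \<longrightarrow>
        oeven_char (t * n) (\<lambda>j. int (l j)) (twisted_vars n \<omega> x) = 0) \<and>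
     (\<forall>r. orthogonal_t_core t (t_core t l) \<and> partition_rank (t_core t l) = r \<longrightarrow>
        oeven_char (t * n) (\<lambda>j. int (l j)) (twisted_vars n \<omega> x) =
          (- 1) powi sign_exponent t n l r
          * of_int (sign (sorting_perm t l (t * n)))
          * oeven_char n (\<lambda>j. int (t_quotient t l (t * n) 0 j)) (\<lambda>i. x i ^ t)
          * (\<Prod>i = 1..(t - 1) div 2.
               schur_char (2 * n) (mu2 t n l i) (power_inverse_vars t n x))
          * (if even t
             then (- 1) ^ (\<Sum>j<n. t_quotient t l (t * n) (t div 2) j)
                  * so_char n (\<lambda>j. int (t_quotient t l (t * n) (t div 2) j)) (\<lambda>i. - (x i ^ t))
             else 1))"
proof -
  note t2 = assms(1) and \<omega> = assms(3) and x = assms(4) and den0 = assms(5) and part = assms(6)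
  have t: "t > 0" and n: "n > 0" using assms by auto
  define N where "N = t * n"
  define y where "y = twisted_vars n \<omega> x"
  define nn where "nn = beta_count t l N"
  define core where "core = t_core t l"
  have anti: "antimono l" using part by (simp add: is_partition_def)
  have zero: "\<forall>j\<ge>t * n. l j = 0" using num_parts_le_iff[OF part] assms(7) by blast
  have core: "is_t_core t core" "is_partition core"
    using t_core_properties(1)[OF part t zero] by (auto simp: core_def is_t_core_def)
  have res: "i < t \<Longrightarrow> int i + int t * k \<in> range (maya core) \<longleftrightarrow> k < int (nn i) - int n" for i k
    using t_core_properties(2)[OF part t zero] by (simp add: core_def nn_def N_def)
  have orth: "orthogonal_t_core t core \<longleftrightarrow> nn 0 = n \<and> (\<forall>i. 0 < i \<and> i < t \<longrightarrow> nn i + nn (t - i) = 2 * n)"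
  proof -
    have "int (nn 0) - int n = 0 \<longleftrightarrow> nn 0 = n" by simp
    moreover have "int (nn i) - int n + (int (nn (t - i)) - int n) = 0 \<longleftrightarrow> nn i + nn (t - i) = 2 * n" for i
      by linarith
    ultimately show ?thesis
      using orthogonal_iff_residues[OF core(2) t res] core(1)
      unfolding orthogonal_t_core_def by simp
  qed
  have rank: "partition_rank core = (\<Sum>i<t. nat (int (nn i) - int n))"
    by (rule partition_rank_eq_sum[OF core(2) t res])
  let ?B = "map (beta l N) [0..<N]"
  let ?F = "folded_entry t n x"
  obtain D where D: "D \<noteq> 0" "\<And>w. length w = t * n \<Longrightarrow>
       D * list_det (\<lambda>i. sym_power (y i)) [0..<t * n] w
         = of_nat t ^ (t * n) * list_det ?F [0..<t * n] w"
    using list_det_fourier[OF \<omega> t n, of x] unfolding y_def by blast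
  define num where "num = list_det (\<lambda>i. sym_power (y i)) [0..<N] ?B"
  have char_eq: "oeven_char N (\<lambda>j. int (l j)) y = num / ((if l (N - 1) = 0 then 2 else 1) * oeven_denom N y)"
    by (simp add: oeven_char_eq num_def)
  have D_num: "D * num = of_nat t ^ N * list_det ?F [0..<N] ?B"
    using D(2)[of ?B] by (simp add: num_def N_def)
  have cnt: "length (filter (\<lambda>c. c mod t = i) ?B) = nn i" for i
    unfolding nn_def beta_count_def
    by (subst length_filter_conv_card) (auto intro!: arg_cong[of _ _ card])
  have part1: "oeven_char N (\<lambda>j. int (l j)) y = 0" if "\<not> orthogonal_t_core t core"
  proof -
    have "length (filter (\<lambda>c. c mod t = 0) ?B) \<noteq> n \<or> (\<exists>i. 0 < i \<and> i < t \<and>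
        length (filter (\<lambda>c. c mod t = i) ?B) + length (filter (\<lambda>c. c mod t = t - i) ?B) \<noteq> 2 * n)"
      unfolding cnt using that orth by blast
    moreover have "length ?B = t * n" by (simp add: N_def)
    ultimately have "list_det ?F [0..<N] ?B = 0"
      using list_det_folded_eq_0[OF t n, of ?B x] unfolding N_def by blast
    then have "num = 0" using D_num D(1) by simp
    then show ?thesis by (simp add: char_eq)
  qed
  have part2: "oeven_char N (\<lambda>j. int (l j)) y =
          (- 1) powi sign_exponent t n l (partition_rank core)
          * of_int (sign (sorting_perm t l N))
          * oeven_char n (\<lambda>j. int (t_quotient t l N 0 j)) (\<lambda>i. x i ^ t)
          * (\<Prod>i = 1..(t - 1) div 2. schur_char (2 * n) (mu2 t n l i) (power_inverse_vars t n x))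
          * (if even t
             then (- 1) ^ (\<Sum>j<n. t_quotient t l N (t div 2) j)
                  * so_char n (\<lambda>j. int (t_quotient t l N (t div 2) j)) (\<lambda>i. - (x i ^ t))
             else 1)" if o: "orthogonal_t_core t core"
  proof -
    have nn0: "nn 0 = n" and nn: "\<And>i. 0 < i \<Longrightarrow> i < t \<Longrightarrow> nn i + nn (t - i) = 2 * n"
      using o orth by auto
    define Q where "Q = quotient_beta t l N"
    \<comment> \<open>The empty partition with \<open>t * n\<close> beads has \<open>n\<close> beads
      on every runner, at the quotients \<open>n - 1, ..., 0\<close>.\<close>
    define E where "E = (\<lambda>_::nat. rev [0..<n])"
    have lenQ: "length (Q i) = nn i" for i by (simp add: Q_def nn_def)
    have lenE: "length (E i) = n" for i by (simp add: E_def)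
    define A where "A = {1..<(t + 1) div 2}"
    define Z where "Z bs = list_det (\<lambda>i. sym_power (x i ^ t)) [0..<n] (bs 0 :: nat list)" for bs :: "nat \<Rightarrow> nat list"
    let ?a = "\<lambda>bs i. (- 1 :: 'a) ^ pair_sign t n bs i"
    let ?p = "pair_factor t n x" and ?m = "middle_factor t n x"
    let ?sg = "of_int (sign (sorting_perm t l N)) :: 'a"
    define e0 where "e0 = (t choose 2) * (Suc n choose 2)"
    have numQ: "D * num = of_nat t ^ N * (?sg * (Z Q * ((\<Prod>i\<in>A. ?a Q i * ?p Q i) * ?m Q)))"
    proof -
      have "list_det ?F [0..<N] ?B = ?sg *
          list_det ?F [0..<N] (concat (map (\<lambda>i. residue_cols t i (Q i)) [0..<t]))"
        unfolding Q_def by (rule list_det_beta[OF anti t]) simp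
      also have "list_det ?F [0..<N] (concat (map (\<lambda>i. residue_cols t i (Q i)) [0..<t]))
          = Z Q * ((\<Prod>i\<in>A. ?a Q i * ?p Q i) * ?m Q)"
        unfolding N_def A_def Z_def
        by (rule list_det_folded_factorization[OF t]) (use lenQ nn0 nn x in auto)
      finally show ?thesis using D_num by simp
    qed
    have denE: "D * oeven_denom N y
        = of_nat t ^ N * ((- 1) ^ e0 * (Z E * ((\<Prod>i\<in>A. ?a E i * ?p E i) * ?m E)))"
    proof -
      have "list_det ?F [0..<N] (rev [0..<N]) = (- 1) ^ e0 *
          list_det ?F [0..<N] (concat (map (\<lambda>i. residue_cols t i (E i)) [0..<t]))"
        using list_det_rev_upt[of "[0..<N]" "[]" t n ?F]
        by (simp add: N_def e0_def E_def residue_cols_def)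
      also have "list_det ?F [0..<N] (concat (map (\<lambda>i. residue_cols t i (E i)) [0..<t]))
          = Z E * ((\<Prod>i\<in>A. ?a E i * ?p E i) * ?m E)"
        unfolding N_def A_def Z_def
        by (rule list_det_folded_factorization[OF t]) (use lenE x in auto)
      finally show ?thesis using D(2)[of "rev [0..<N]"] by (simp add: oeven_denom_eq N_def)
    qed
    have "num / oeven_denom N y = (D * num) / (D * oeven_denom N y)" using D(1) by simp
    also have "\<dots> = (?sg * (Z Q * ((\<Prod>i\<in>A. ?a Q i * ?p Q i) * ?m Q))) /
        ((- 1) ^ e0 * (Z E * ((\<Prod>i\<in>A. ?a E i * ?p E i) * ?m E)))"
      unfolding numQ denE using t by simp
    also have "\<dots> = (?sg / (- 1) ^ e0) * (Z Q / Z E) *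
        ((\<Prod>i\<in>A. ?a Q i * ?p Q i) / (\<Prod>i\<in>A. ?a E i * ?p E i)) * (?m Q / ?m E)"
      by (simp only: times_divide_times_eq mult.assoc)
    also have "(\<Prod>i\<in>A. ?a Q i * ?p Q i) / (\<Prod>i\<in>A. ?a E i * ?p E i)
        = (\<Prod>i\<in>A. ?a Q i * ?a E i) * (\<Prod>i\<in>A. ?p Q i / ?p E i)"
    proof -
      have "(\<Prod>i\<in>A. ?a Q i * ?p Q i) / (\<Prod>i\<in>A. ?a E i * ?p E i)
          = (\<Prod>i\<in>A. (?a Q i * ?p Q i) / (?a E i * ?p E i))"
        by (rule prod_dividef[symmetric])
      \<comment> \<open>Signs are their own inverses, so those of the denominator can be multiplied
        instead of divided.\<close>
      also have "\<dots> = (\<Prod>i\<in>A. (?a Q i * ?a E i) * (?p Q i / ?p E i))"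
        by (rule prod.cong) (auto simp: minus_one_power_iff)
      finally show ?thesis by (simp only: prod.distrib)
    qed
    also have "?sg / (- 1) ^ e0 = ?sg * (- 1) ^ e0" by (simp add: minus_one_power_iff)
    also have "(\<Prod>i\<in>A. ?a Q i * ?a E i) = (- 1) ^ (\<Sum>i\<in>A. pair_sign t n Q i + pair_sign t n E i)"
      by (simp add: power_sum power_add)
    finally have ratio: "num / oeven_denom N y =
        ((- 1) ^ (e0 + (\<Sum>i\<in>A. pair_sign t n Q i + pair_sign t n E i))) * ?sg * (Z Q / Z E) *
        (\<Prod>i\<in>A. ?p Q i / ?p E i) * (?m Q / ?m E)"
      by (simp add: power_add mult_ac)
    have rk: "even (partition_rank core) \<longleftrightarrow> even (\<Sum>i = 1..<(t + 1) div 2. nn (t - i) + n)" if "even t"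
      unfolding rank using rank_parity[OF t2 that nn0 nn] by blast
    have sgn: "(- 1 :: 'a) powi sign_exponent t n l (partition_rank core)
        = (- 1) ^ (e0 + (\<Sum>i\<in>A. pair_sign t n Q i + pair_sign t n E i))"
      using sign_exponent_parity[of t "partition_rank core" nn n, OF t2 rk]
      unfolding sign_exponent_def e0_def A_def pair_sign_def lenQ lenE
      by (intro minus_one_powi_eq) (simp only: nn_def N_def)
    have schur: "(\<Prod>i\<in>A. ?p Q i / ?p E i)
        = (\<Prod>i = 1..(t - 1) div 2. schur_char (2 * n) (mu2 t n l i) (power_inverse_vars t n x))"
    proof (rule prod.cong)
      show "A = {1..(t - 1) div 2}" using t by (auto simp: A_def)
      fix i assume "i \<in> {1..(t - 1) div 2}"
      then have "0 < i" "i < t" by auto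
      then show "?p Q i / ?p E i = schur_char (2 * n) (mu2 t n l i) (power_inverse_vars t n x)"
        using schur_char_mu2[OF x, of t l i] nn[of i] by (simp add: Q_def E_def N_def nn_def)
    qed
    have mid: "?m Q / ?m E = (if even t
             then (- 1) ^ (\<Sum>j<n. t_quotient t l N (t div 2) j)
                  * so_char n (\<lambda>j. int (t_quotient t l N (t div 2) j)) (\<lambda>i. - (x i ^ t))
             else 1)"
    proof (cases "even t")
      case True
      then obtain h where h: "t = 2 * h" by auto
      then have "h > 0" "beta_count t l N h = n" using t nn[of h] by (auto simp: nn_def)
      from middle_factor_ratio[OF h this(1) x this(2)] h show ?thesis by (simp add: Q_def E_def)
    qed (simp add: middle_factor_def)
    have QZ: "Q 0 = map (beta (t_quotient t l N 0) n) [0..<n]"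
      using nn0 by (simp add: Q_def quotient_beta_def beta_def nn_def)
    have last: "l (N - 1) = 0 \<longleftrightarrow> t_quotient t l N 0 (n - 1) = 0"
      using last_part_eq_0_iff[OF anti t n] nn0 by (simp add: N_def nn_def)
    have oeven: "oeven_char n (\<lambda>j. int (t_quotient t l N 0 j)) (\<lambda>i. x i ^ t)
        = (Z Q / Z E) / (if l (N - 1) = 0 then 2 else 1)"
      unfolding oeven_char_eq oeven_denom_eq last Z_def QZ E_def by simp
    have "oeven_char N (\<lambda>j. int (l j)) y = (num / oeven_denom N y) / (if l (N - 1) = 0 then 2 else 1)"
      by (simp add: char_eq)
    then show ?thesis
      unfolding ratio sgn schur[symmetric] mid[symmetric] oeven by simp
  qed
  show ?thesis
    using part1 part2 unfolding core_def N_def y_def by blast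
qed

end
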